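(* Let $\mathcal S=\{S_j\}_{j=1}^N$ be an IFS on $\mathbb R^d$ satisfying the open set condition and possessing a skeleton $A=\{a_1,\dots,a_m\}$, and let $K$ be its (connected) invariant set. Let $\Lambda=(A,V)$ be an initial graph, let $G=\bigcup_{j=1}^N S_j(\Lambda)$ be its refined graph, and let $\tau:u\mapsto P_u$ ($u\in V$) be an edge-to-trail substitution. If every trail $P_u$, $u\in V$, is a traveling trail, then $\tau$ leads to a space-filling curve of $K$.
   Context: An IFS is a finite family $\mathcal S=\{S_j\}_{j=1}^N$, $N\ge 2$, of contractive similitudes of $\mathbb R^d$; its invariant set $K$ is the unique nonempty compact set with $K=\bigcup_{j=1}^N S_j(K)$. It satisfies the open set condition if there is a nonempty open set $U\subset\mathbb R^d$ with $\bigcup_i S_i(U)\subset U$ and the sets $S_i(U)$ pairwise disjoint. Skeleton. For a finite set $A\subset K$, the Hata graph $H(\mathcal S,A)$ is the undirected graph with vertices $S_1,\dots,S_N$ in which $S_i,S_j$ ($i\ne j$) are adjacent iff $S_i(A)\cap S_j(A)\neq\emptyset$. If $K$ is connected, a finite set $A\subset K$ is a skeleton if $A\subset\bigcup_{j}S_j(A)$ and $H(\mathcal S,A)$ is connected. Graphs. A walk in a directed graph is written $e_1+\dots+e_k$ (consecutive edges); its origin is the origin of $e_1$ and its terminus the terminus of $e_k$. A trail is a walk with distinct edges. Let $G_0=\{\overrightarrow{a_ia_j}:1\le i,j\le m\}$ be the complete directed graph on $A$ (abstract edges, $i=j$ allowed). An initial graph is a spanning subgraph $\Lambda=(A,V)$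 of $G_0$ with nonempty edge set $V$. $S_j(\Lambda)$ is the directed graph with vertex set $S_j(A)$ and one edge $S_j(e)=(e,S_j)$ from $S_j(x)$ to $S_j(y)$ for each edge $e\in V$ from $x$ to $y$; the edges $(e,S_j)$ and $(e',S_{j'})$ are regarded as different whenever $(e,j)\ne(e',j')$. The refined graph is $G=\bigcup_{j=1}^N S_j(\Lambda)$. An edge-to-trail substitution is a map $\tau$ assigning to each $u\in V$ a trail $P_u$ in $G$ with the same origin and terminus as $u$. A traveling trail is a trail of length $N$ in $G$ that contains exactly one edge of $S_j(\Lambda)$ for every $j\in\{1,\dots,N\}$. Optimal parametrization. For a compact $F\subset\mathbb R^d$ with $0<\mathcal H^s(F)<\infty$ ($\mathcal H^s$ = $s$-dimensional Hausdorff measure), an onto map $\psi:[0,1]\to F$ is an optimal parametrization if (i) there are full-measure subsets $F'\subset F$, $I'\subset[0,1]$ with $\psi:I'\to F'$ bijective; (ii) with $c=\mathcal H^s(F)$, $\mathcal H^s(\psi(X))=c\,\mathcal L(X)$ for Borel $X\subset[0,1]$ and $\mathcal L(\psi^{-1}(B))=c^{-1}\mathcal H^s(B)$ for Borel $B\subset F$ ($\mathcal L$ = Lebesgue measure); (iii) $|\psi(x)-\psi(y)|\le c'|x-y|^{1/s}$ for some $c'>0$ and all $x,y\in[0,1]$. "Space-filling curve" means optimal parametrization; here $s=\dim_H K$. "Leads to". If $P_u=S_{u,1}(v_{u,1})+\dots+S_{u,\ell_u}(v_{u,\ell_u})$ with $S_{u,j}\in\mathcal S$, $v_{u,j}\in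 V$, let $(E_u)_{u\in V}$ be the unique nonempty compact sets with $E_u=\bigcup_{j=1}^{\ell_u}S_{u,j}(E_{v_{u,j}})$, $u\in V$ (the invariant sets of the graph-directed IFS induced by $\tau$). We say $\tau$ leads to a space-filling curve of $K$ if there is a trail $u_1+\dots+u_k$ in $\Lambda$ ($k\ge1$) such that $K=\bigcup_iE_{u_i}$, $\mathcal H^s(E_{u_i}\cap E_{u_j})=0$ for $i\ne j$, each $E_{u_i}$ has an optimal parametrization $\varphi_i$ with $\varphi_i(0)$ and $\varphi_i(1)$ the origin and terminus of $u_i$, and the concatenation of $\varphi_1,\dots,\varphi_k$ (with $\varphi_i$ run on an interval of length $\mathcal H^s(E_{u_i})/\mathcal H^s(K)$) is an optimal parametrization of $K$. *)

theory Defs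
  imports "HOL-Analysis.Analysis" "Graph_Theory.Digraph_Component"
begin

section \<open>Hausdorff measure and dimension\<close>

text \<open>
  The summand \<open>diam(U)\<^sup>s\<close> with the usual conventions \<open>diam({})\<^sup>s = 0\<close> for all \<open>s\<close> and
  \<open>0\<^sup>0 = 1\<close> for nonempty \<open>U\<close>; a bare \<open>powr\<close> would give \<open>0 powr 0 = 0\<close>.
\<close>

definition diam_pow :: "real \<Rightarrow> 'a::metric_space set \<Rightarrow> ennreal" where
  "diam_pow s U =
     (if U = {} then 0 else if s = 0 then 1 else ennreal (diameter U powr s))"

text \<open>
  Covering sets are required to be bounded because \<^const>\<open>diameter\<close> carries no information on
  unbounded sets. Finite covers are included, as \<open>U i\<close> may be empty. The measure is defined on
  all sets, as an outer measure, without a normalizing factor.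
\<close>

definition hausdorff_premeasure :: "real \<Rightarrow> real \<Rightarrow> 'a::metric_space set \<Rightarrow> ennreal" where
  "hausdorff_premeasure s \<delta> F =
     (INF U\<in>{U :: nat \<Rightarrow> 'a set. F \<subseteq> (\<Union>i. U i) \<and> (\<forall>i. bounded (U i) \<and> diameter (U i) \<le> \<delta>)}.
        \<Sum>i. diam_pow s (U i))"

definition hausdorff_measure :: "real \<Rightarrow> 'a::metric_space set \<Rightarrow> ennreal" where
  "hausdorff_measure s F = (SUP \<delta>\<in>{0<..}. hausdorff_premeasure s \<delta> F)"

definition hausdorff_dim :: "'a::euclidean_space set \<Rightarrow> real" where
  "hausdorff_dim F = Inf {s. 0 \<le> s \<and> hausdorff_measure s F = 0}"


section \<open>Iterated function systems\<close>

text \<open>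
  A family \<open>S\<^sub>1, \<dots>, S\<^sub>N\<close> of maps is a function \<open>S\<close> on indices, of which only the values on
  \<open>{1..N}\<close> matter.
\<close>

definition contractive_similitude :: "('a::metric_space \<Rightarrow> 'a) \<Rightarrow> bool" where
  "contractive_similitude f \<longleftrightarrow> (\<exists>r. 0 < r \<and> r < 1 \<and> (\<forall>x y. dist (f x) (f y) = r * dist x y))"

definition is_ifs :: "nat \<Rightarrow> (nat \<Rightarrow> 'a::metric_space \<Rightarrow> 'a) \<Rightarrow> bool" where
  "is_ifs N S \<longleftrightarrow> 2 \<le> N \<and> (\<forall>j\<in>{1..N}. contractive_similitude (S j))"

definition invariant_set :: "nat \<Rightarrow> (nat \<Rightarrow> 'a::metric_space \<Rightarrow> 'a) \<Rightarrow> 'a set \<Rightarrow> bool" where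
  "invariant_set N S K \<longleftrightarrow> K \<noteq> {} \<and> compact K \<and> K = (\<Union>j\<in>{1..N}. S j ` K)"

definition open_set_condition :: "nat \<Rightarrow> (nat \<Rightarrow> 'a::topological_space \<Rightarrow> 'a) \<Rightarrow> bool" where
  "open_set_condition N S \<longleftrightarrow>
     (\<exists>U. open U \<and> U \<noteq> {} \<and> (\<Union>j\<in>{1..N}. S j ` U) \<subseteq> U \<and>
          disjoint_family_on (\<lambda>j. S j ` U) {1..N})"

text \<open>The undirected Hata graph is encoded as a symmetric digraph on the indices.\<close>

definition hata_graph ::
  "nat \<Rightarrow> (nat \<Rightarrow> 'a \<Rightarrow> 'a) \<Rightarrow> 'a set \<Rightarrow> (nat, nat \<times> nat) pre_digraph" where
  "hata_graph N S A =
     \<lparr> verts = {1..N},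
       arcs = {(i, j). i \<in> {1..N} \<and> j \<in> {1..N} \<and> i \<noteq> j \<and> S i ` A \<inter> S j ` A \<noteq> {}},
       tail = fst, head = snd \<rparr>"

definition is_skeleton ::
  "nat \<Rightarrow> (nat \<Rightarrow> 'a::metric_space \<Rightarrow> 'a) \<Rightarrow> 'a set \<Rightarrow> 'a set \<Rightarrow> bool" where
  "is_skeleton N S K A \<longleftrightarrow>
     Topological_Spaces.connected K \<and> finite A \<and> A \<subseteq> K \<and> A \<subseteq> (\<Union>j\<in>{1..N}. S j ` A) \<and>
     Digraph_Component.connected (hata_graph N S A)"


section \<open>Initial graphs, refined graphs and substitutions\<close>

definition complete_digraph :: "'a set \<Rightarrow> ('a, 'a \<times> 'a) pre_digraph" where
  "complete_digraph A = \<lparr> verts = A, arcs = A \<times> A, tail = fst, head = snd \<rparr>"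

definition initial_graph :: "'a set \<Rightarrow> ('a, 'a \<times> 'a) pre_digraph \<Rightarrow> bool" where
  "initial_graph A \<Lambda> \<longleftrightarrow> spanning \<Lambda> (complete_digraph A) \<and> arcs \<Lambda> \<noteq> {}"

text \<open>
  The edge \<open>S\<^sub>j(e)\<close> is the pair \<open>(e, j)\<close>. The end maps below make sense for all pairs, so that
  all the graphs \<open>S\<^sub>j(\<Lambda>)\<close>, and their union, share them.
\<close>

definition image_graph ::
  "(nat \<Rightarrow> 'a \<Rightarrow> 'a) \<Rightarrow> ('a, 'b) pre_digraph \<Rightarrow> nat \<Rightarrow> ('a, 'b \<times> nat) pre_digraph" where
  "image_graph S \<Lambda> j =
     \<lparr> verts = S j ` verts \<Lambda>, arcs = arcs \<Lambda> \<times> {j},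
       tail = (\<lambda>(e, i). S i (tail \<Lambda> e)), head = (\<lambda>(e, i). S i (head \<Lambda> e)) \<rparr>"

definition refined_graph ::
  "nat \<Rightarrow> (nat \<Rightarrow> 'a \<Rightarrow> 'a) \<Rightarrow> ('a, 'b) pre_digraph \<Rightarrow> ('a, 'b \<times> nat) pre_digraph" where
  "refined_graph N S \<Lambda> =
     \<lparr> verts = (\<Union>j\<in>{1..N}. verts (image_graph S \<Lambda> j)),
       arcs = (\<Union>j\<in>{1..N}. arcs (image_graph S \<Lambda> j)),
       tail = (\<lambda>(e, i). S i (tail \<Lambda> e)), head = (\<lambda>(e, i). S i (head \<Lambda> e)) \<rparr>"

text \<open>Unlike \<^const>\<open>pre_digraph.trail\<close>, walks here have at least one edge.\<close>

definition is_trail :: "('a, 'b) pre_digraph \<Rightarrow> 'a \<Rightarrow> 'b list \<Rightarrow> 'a \<Rightarrow> bool" where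
  "is_trail G x p y \<longleftrightarrow> p \<noteq> [] \<and> pre_digraph.trail G x p y"

definition edge_to_trail_substitution ::
  "nat \<Rightarrow> (nat \<Rightarrow> 'a \<Rightarrow> 'a) \<Rightarrow> ('a, 'b) pre_digraph \<Rightarrow> ('b \<Rightarrow> ('b \<times> nat) list) \<Rightarrow> bool" where
  "edge_to_trail_substitution N S \<Lambda> \<tau> \<longleftrightarrow>
     (\<forall>u\<in>arcs \<Lambda>. is_trail (refined_graph N S \<Lambda>) (tail \<Lambda> u) (\<tau> u) (head \<Lambda> u))"

definition traveling_trail ::
  "nat \<Rightarrow> (nat \<Rightarrow> 'a \<Rightarrow> 'a) \<Rightarrow> ('a, 'b) pre_digraph \<Rightarrow> ('b \<times> nat) list \<Rightarrow> bool" where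
  "traveling_trail N S \<Lambda> p \<longleftrightarrow>
     (\<exists>x y. is_trail (refined_graph N S \<Lambda>) x p y) \<and> length p = N \<and>
     (\<forall>j\<in>{1..N}. \<exists>!e. e \<in> set p \<and> e \<in> arcs (image_graph S \<Lambda> j))"

text \<open>
  The defining property of the invariant sets of the graph-directed system induced by \<open>\<tau>\<close>.
  Only the sets \<open>E u\<close> with \<open>u\<close> an edge of \<open>\<Lambda>\<close> are meant; these are unique, by the lemma
  \<open>graph_directed_invariant_sets_unique\<close> below.
\<close>

definition graph_directed_invariant_sets ::
  "(nat \<Rightarrow> 'a::metric_space \<Rightarrow> 'a) \<Rightarrow> ('a, 'b) pre_digraph \<Rightarrow> ('b \<Rightarrow> ('b \<times> nat) list) \<Rightarrow>
   ('b \<Rightarrow> 'a set) \<Rightarrow> bool" where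
  "graph_directed_invariant_sets S \<Lambda> \<tau> E \<longleftrightarrow>
     (\<forall>u\<in>arcs \<Lambda>. E u \<noteq> {} \<and> compact (E u) \<and> E u = (\<Union>(v, j)\<in>set (\<tau> u). S j ` E v))"

lemma graph_directed_invariant_sets_subset:
  fixes S :: "nat \<Rightarrow> 'a::metric_space \<Rightarrow> 'a"
  assumes ifs: "is_ifs N S" and fin: "finite (arcs \<Lambda>)"
    and sub: "edge_to_trail_substitution N S \<Lambda> \<tau>"
    and E: "graph_directed_invariant_sets S \<Lambda> \<tau> E"
    and F: "graph_directed_invariant_sets S \<Lambda> \<tau> F"
    and u: "u \<in> arcs \<Lambda>"
  shows "E u \<subseteq> F u"
proof -
  have "\<exists>\<rho>. \<forall>j\<in>{1..N}. 0 < \<rho> j \<and> \<rho> j < 1 \<and> (\<forall>x y. dist (S j x) (S j y) = \<rho> j * dist x y)"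
    using ifs unfolding is_ifs_def contractive_similitude_def by (intro bchoice) auto
  then obtain \<rho> where \<rho>: "\<And>j. j \<in> {1..N} \<Longrightarrow> 0 < \<rho> j" "\<And>j. j \<in> {1..N} \<Longrightarrow> \<rho> j < 1"
    "\<And>j x y. j \<in> {1..N} \<Longrightarrow> dist (S j x) (S j y) = \<rho> j * dist x y"
    by metis
  have N: "1 \<in> {1..N}" using ifs by (auto simp: is_ifs_def)
  define r where "r = Max (\<rho> ` {1..N})"
  have r1: "r < 1" unfolding r_def using N \<rho>(2) by (subst Max_less_iff) auto
  have rge: "\<rho> j \<le> r" if "j \<in> {1..N}" for j unfolding r_def using that by auto
  have r0: "0 < r" using \<rho>(1)[OF N] rge[OF N] by linarith
  have edges: "v \<in> arcs \<Lambda> \<and> j \<in> {1..N}" if "w \<in> arcs \<Lambda>" "(v, j) \<in> set (\<tau> w)" for v w j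
  proof -
    have "set (\<tau> w) \<subseteq> arcs (refined_graph N S \<Lambda>)"
      using sub that(1)
      by (auto simp: edge_to_trail_substitution_def is_trail_def pre_digraph.trail_def
          pre_digraph.awalk_def)
    then show ?thesis using that(2) by (auto simp: refined_graph_def image_graph_def)
  qed
  have Ec: "compact (E w)" and Fc: "compact (F w)" and Fne: "F w \<noteq> {}"
    if "w \<in> arcs \<Lambda>" for w
    using E F that unfolding graph_directed_invariant_sets_def by blast+
  have "bounded (\<Union>w\<in>arcs \<Lambda>. E w \<union> F w)"
    using Ec Fc by (intro bounded_UN fin ballI) (simp add: compact_imp_bounded)
  then obtain D where D: "\<And>x y. x \<in> (\<Union>w\<in>arcs \<Lambda>. E w \<union> F w) \<Longrightarrow>
      y \<in> (\<Union>w\<in>arcs \<Lambda>. E w \<union> F w) \<Longrightarrow> dist x y \<le> D"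
    unfolding bounded_two_points by blast
  have Eeq: "E w = (\<Union>(v, j)\<in>set (\<tau> w). S j ` E v)"
    and Feq: "F w = (\<Union>(v, j)\<in>set (\<tau> w). S j ` F v)" if "w \<in> arcs \<Lambda>" for w
    using E F that unfolding graph_directed_invariant_sets_def by blast+
  have step: "\<forall>w\<in>arcs \<Lambda>. \<forall>x\<in>E w. infdist x (F w) \<le> r ^ n * D" for n
  proof (induction n)
    case 0
    show ?case
    proof (intro ballI)
      fix w x assume w: "w \<in> arcs \<Lambda>" and x: "x \<in> E w"
      obtain z where z: "z \<in> F w" using Fne[OF w] by auto
      have "infdist x (F w) \<le> dist x z" by (rule infdist_le[OF z])
      also have "\<dots> \<le> D" using w x z by (intro D) auto
      finally show "infdist x (F w) \<le> r ^ 0 * D" by simp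
    qed
  next
    case (Suc n)
    show ?case
    proof (intro ballI)
      fix w x assume w: "w \<in> arcs \<Lambda>" and x: "x \<in> E w"
      obtain v j y where vj: "(v, j) \<in> set (\<tau> w)" and y: "y \<in> E v" "x = S j y"
        using x Eeq[OF w] by auto
      have v: "v \<in> arcs \<Lambda>" and j: "j \<in> {1..N}" using edges[OF w vj] by auto
      obtain z where z: "z \<in> F v" "\<And>z'. z' \<in> F v \<Longrightarrow> dist y z \<le> dist y z'"
        using continuous_attains_inf[OF Fc[OF v] Fne[OF v], of "dist y"]
        by (force intro: continuous_intros)
      have "dist y z \<le> infdist y (F v)"
        unfolding infdist_notempty[OF Fne[OF v]] using z(2) Fne[OF v] by (intro cINF_greatest)
      also have "\<dots> \<le> r ^ n * D" using Suc.IH v y(1) by auto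
      finally have yz: "dist y z \<le> r ^ n * D" .
      have "S j z \<in> F w" using Feq[OF w] vj z(1) by auto
      then have "infdist x (F w) \<le> dist (S j y) (S j z)" unfolding y(2) by (rule infdist_le)
      also have "\<dots> = \<rho> j * dist y z" by (rule \<rho>(3)[OF j])
      also have "\<dots> \<le> r * (r ^ n * D)"
        using yz rge[OF j] r0 by (intro mult_mono) auto
      finally show "infdist x (F w) \<le> r ^ Suc n * D" by (simp add: mult.assoc)
    qed
  qed
  show ?thesis
  proof
    fix x assume x: "x \<in> E u"
    have "(\<lambda>n. r ^ n * D) \<longlonglongrightarrow> 0"
      using r0 r1 by (intro tendsto_mult_left_zero LIMSEQ_power_zero) auto
    then have "infdist x (F u) \<le> 0"
      using step u x by (intro LIMSEQ_le_const) auto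
    then have "infdist x (F u) = 0" using infdist_nonneg[of x "F u"] by linarith
    then show "x \<in> F u"
      using in_closed_iff_infdist_zero[OF compact_imp_closed[OF Fc[OF u]] Fne[OF u]] by blast
  qed
qed

lemma graph_directed_invariant_sets_unique:
  assumes "is_ifs N S" "finite (arcs \<Lambda>)" "edge_to_trail_substitution N S \<Lambda> \<tau>"
    and "graph_directed_invariant_sets S \<Lambda> \<tau> E" "graph_directed_invariant_sets S \<Lambda> \<tau> F"
    and "u \<in> arcs \<Lambda>"
  shows "E u = F u"
  using graph_directed_invariant_sets_subset[OF assms]
    graph_directed_invariant_sets_subset[OF assms(1-3) assms(5) assms(4) assms(6)] by blast


section \<open>Optimal parametrizations and space-filling curves\<close>

text \<open>
  The preimage in the second part of (ii) is a Borel set, because (iii) makes \<open>\<psi>\<close> continuous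
  on the unit interval when \<open>s > 0\<close>.
\<close>

definition optimal_parametrization ::
  "real \<Rightarrow> 'a::metric_space set \<Rightarrow> (real \<Rightarrow> 'a) \<Rightarrow> bool" where
  "optimal_parametrization s F \<psi> \<longleftrightarrow>
     compact F \<and> 0 < hausdorff_measure s F \<and> hausdorff_measure s F < \<infinity> \<and>
     \<psi> ` {0..1} = F \<and>
     (\<exists>F' I'. F' \<subseteq> F \<and> hausdorff_measure s (F - F') = 0 \<and>
              I' \<subseteq> {0..1} \<and> {0..1} - I' \<in> null_sets lebesgue \<and> bij_betw \<psi> I' F') \<and>
     (\<forall>X\<in>sets borel. X \<subseteq> {0..1} \<longrightarrow>
        hausdorff_measure s (\<psi> ` X) = hausdorff_measure s F * emeasure lebesgue X) \<and>
     (\<forall>B\<in>sets borel. B \<subseteq> F \<longrightarrow>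
        emeasure lebesgue {t \<in> {0..1}. \<psi> t \<in> B} = hausdorff_measure s B / hausdorff_measure s F) \<and>
     (\<exists>c'>0. \<forall>x\<in>{0..1}. \<forall>y\<in>{0..1}. dist (\<psi> x) (\<psi> y) \<le> c' * \<bar>x - y\<bar> powr (1 / s))"

text \<open>
  Concatenation of \<open>\<phi> 0, \<phi> 1, \<dots>\<close>, where \<open>\<phi> i\<close> is run at constant speed on the \<open>i\<close>-th of
  consecutive intervals of lengths \<open>len 0, len 1, \<dots>\<close>, starting at 0. At a common endpoint of two
  intervals the earlier curve is used.
\<close>

definition concatenation :: "(nat \<Rightarrow> real) \<Rightarrow> (nat \<Rightarrow> real \<Rightarrow> 'a) \<Rightarrow> real \<Rightarrow> 'a" where
  "concatenation len \<phi> t =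
     (let i = (LEAST i. t \<le> (\<Sum>j\<le>i. len j)) in \<phi> i ((t - (\<Sum>j<i. len j)) / len i))"

definition leads_to_space_filling_curve ::
  "(nat \<Rightarrow> 'a::euclidean_space \<Rightarrow> 'a) \<Rightarrow> 'a set \<Rightarrow> ('a, 'b) pre_digraph \<Rightarrow>
   ('b \<Rightarrow> ('b \<times> nat) list) \<Rightarrow> bool" where
  "leads_to_space_filling_curve S K \<Lambda> \<tau> \<longleftrightarrow>
     (let s = hausdorff_dim K in
      \<exists>E us x y \<phi>.
        graph_directed_invariant_sets S \<Lambda> \<tau> E \<and>
        is_trail \<Lambda> x us y \<and>
        K = (\<Union>i<length us. E (us ! i)) \<and>
        (\<forall>i<length us. \<forall>j<length us. i \<noteq> j \<longrightarrow>
           hausdorff_measure s (E (us ! i) \<inter> E (us ! j)) = 0) \<and>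
        (\<forall>i<length us. optimal_parametrization s (E (us ! i)) (\<phi> i) \<and>
           \<phi> i 0 = tail \<Lambda> (us ! i) \<and> \<phi> i 1 = head \<Lambda> (us ! i)) \<and>
        optimal_parametrization s K
          (concatenation
             (\<lambda>i. enn2real (hausdorff_measure s (E (us ! i)) / hausdorff_measure s K)) \<phi>))"

end

theory Submission
  imports Defs
begin

text \<open>
  A traveling trail of length \<open>N\<close> uses each index \<open>1, \<dots>, N\<close> exactly once. So every equation of the
  graph-directed system induced by \<open>\<tau>\<close> has the right-hand side \<open>\<Union>\<^sub>j S\<^sub>j(\<dots>)\<close> with all \<open>j\<close> present, and
  the constant family \<open>E\<^sub>u = K\<close> solves it. A single edge \<open>u\<close> of \<open>\<Lambda>\<close> is then already a suitable trail:
  it remains to find an optimal parametrization of \<open>K\<close> that leads from the origin to the terminus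
  of \<open>u\<close>.

  Let \<open>s\<close> be the exponent with \<open>\<Sum>\<^sub>j r\<^sub>j\<^sup>s = 1\<close>. The trail \<open>P\<^sub>u\<close> cuts \<open>[0, 1]\<close> into \<open>N\<close> cells, the \<open>k\<close>-th of
  length \<open>r\<^sub>j\<^sup>s\<close> if the \<open>k\<close>-th edge of \<open>P\<^sub>u\<close> is \<open>S\<^sub>j(v)\<close>, and on that cell the curve of \<open>u\<close> has to be the
  image under \<open>S\<^sub>j\<close> of the curve of \<open>v\<close>. These equations for all edges at once are solved by iteration,
  because the \<open>S\<^sub>j\<close> contract. The pieces fit together since the edges of \<open>P\<^sub>u\<close> are consecutive
  (lemma \<open>curve_cell\<close>), and comparing \<open>r\<^sub>j\<close> with the length \<open>r\<^sub>j\<^sup>s\<close> makes the curves Hoelder continuous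
  with exponent \<open>1 / s\<close> (lemma \<open>curve_holder\<close>).

  Writing \<open>H\<close> for the \<open>s\<close>-dimensional Hausdorff measure, the Hoelder bound gives \<open>H(K) < \<infinity>\<close>. For
  \<open>H(K) > 0\<close>, the open set condition bounds the time that a curve spends in a ball of radius \<open>\<delta>\<close> by a
  constant times \<open>\<delta>\<^sup>s\<close>: by self-similarity this time is controlled, at every scale, by the volume of the
  part of the open set near the ball, and volumes of disjoint pieces add up
  (lemma \<open>occupation_le_volume\<close>). Hence \<open>s\<close> is the Hausdorff dimension of \<open>K\<close>.

  For measure preservation, subadditivity of \<open>H\<close> is enough. An arc over a cell is a scaled copy of
  \<open>K\<close>, so it has measure at most \<open>H(K)\<close> times the length of the cell; covering by cells extends this to all
  arcs (lemma \<open>hausdorff_measure_arc_le\<close>), and covering by intervals to the images of all Borel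
  sets \<open>X\<close>. As the bounds for \<open>X\<close> and for its complement in \<open>[0, 1]\<close> add up to \<open>H(K)\<close>, both are equalities.
  This determines preimages as well, and it forces the curve to be injective off a null set: the
  preimage of an arc exceeds the parameter interval of the arc only by a null set
  (lemma \<open>optimal_parametrizationI\<close>).
\<close>

section \<open>Hausdorff measure as an outer measure\<close>

lemma hausdorff_premeasure_mono:
  "X \<subseteq> Y \<Longrightarrow> hausdorff_premeasure s \<delta> X \<le> hausdorff_premeasure s \<delta> Y"
  unfolding hausdorff_premeasure_def by (rule INF_superset_mono) auto

lemma hausdorff_measure_mono:
  "X \<subseteq> Y \<Longrightarrow> hausdorff_measure s X \<le> hausdorff_measure s Y"
  unfolding hausdorff_measure_def by (intro SUP_mono) (blast intro: hausdorff_premeasure_mono)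

lemma hausdorff_premeasure_le_finite_cover:
  fixes U :: "nat \<Rightarrow> 'a::metric_space set"
  assumes "X \<subseteq> (\<Union>i<n. U i)" and "\<And>i. i < n \<Longrightarrow> bounded (U i) \<and> diameter (U i) \<le> \<delta>" and "0 \<le> \<delta>"
  shows "hausdorff_premeasure s \<delta> X \<le> (\<Sum>i<n. diam_pow s (U i))"
proof -
  let ?W = "\<lambda>i. if i < n then U i else {}"
  have "X \<subseteq> (\<Union>i. ?W i)" using assms(1) by fastforce
  then have "hausdorff_premeasure s \<delta> X \<le> (\<Sum>i. diam_pow s (?W i))"
    unfolding hausdorff_premeasure_def using assms by (intro INF_lower) auto
  also have "\<dots> = (\<Sum>i<n. diam_pow s (?W i))"
    by (rule suminf_finite) (auto simp: diam_pow_def)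
  also have "\<dots> = (\<Sum>i<n. diam_pow s (U i))" by (rule sum.cong) auto
  finally show ?thesis .
qed

lemma hausdorff_measure_empty [simp]: "hausdorff_measure s {} = 0"
proof -
  have "hausdorff_premeasure s \<delta> {} = 0" if "\<delta> > 0" for \<delta>
    using hausdorff_premeasure_le_finite_cover[of "{}" "\<lambda>_. {}" 0 \<delta> s] that by simp
  then show ?thesis unfolding hausdorff_measure_def by (intro antisym SUP_least) auto
qed

lemma hausdorff_measure_singleton:
  assumes "0 < s"
  shows "hausdorff_measure s {x} = 0"
proof -
  have "hausdorff_premeasure s \<delta> {x} \<le> 0" if "\<delta> > 0" for \<delta>
    using hausdorff_premeasure_le_finite_cover[of "{x}" "\<lambda>_. {x}" 1 \<delta> s] that assms
    by (simp add: diam_pow_def lessThan_Suc)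
  then show ?thesis unfolding hausdorff_measure_def by (intro antisym SUP_least) auto
qed

text \<open>
  Covers that are optimal up to \<open>e / 2\<^sup>i\<^sup>+\<^sup>1\<close> for the \<open>i\<close>-th set are merged into one sequence with
  the help of \<^const>\<open>prod_decode\<close>.
\<close>

lemma hausdorff_premeasure_UN_le:
  "hausdorff_premeasure s \<delta> (\<Union>i. X i) \<le> (\<Sum>i. hausdorff_premeasure s \<delta> (X i))"
proof (rule ennreal_le_epsilon)
  fix e :: real
  assume fin: "(\<Sum>i. hausdorff_premeasure s \<delta> (X i)) < top" and e: "0 < e"
  have "\<exists>U. X i \<subseteq> (\<Union>k. U k) \<and> (\<forall>k. bounded (U k) \<and> diameter (U k) \<le> \<delta>) \<and>
      (\<Sum>k. diam_pow s (U k)) < hausdorff_premeasure s \<delta> (X i) + ennreal (e * (1/2) ^ Suc i)" for i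
  proof -
    have "hausdorff_premeasure s \<delta> (X i) < top"
      using fin by (meson ennreal_suminf_lessD)
    then have "hausdorff_premeasure s \<delta> (X i) + 0 <
        hausdorff_premeasure s \<delta> (X i) + ennreal (e * (1/2) ^ Suc i)"
      using e by (subst ennreal_add_left_cancel_less) auto
    then show ?thesis
      unfolding add_0_right hausdorff_premeasure_def[of s \<delta> "X i"] INF_less_iff by auto
  qed
  then obtain U where U: "\<And>i. X i \<subseteq> (\<Union>k. U i k)"
    "\<And>i k. bounded (U i k) \<and> diameter (U i k) \<le> \<delta>"
    "\<And>i. (\<Sum>k. diam_pow s (U i k)) \<le> hausdorff_premeasure s \<delta> (X i) + ennreal (e * (1/2) ^ Suc i)"
    by (metis less_imp_le)
  let ?W = "\<lambda>n. case prod_decode n of (i, k) \<Rightarrow> U i k"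
  have "(\<Union>i. X i) \<subseteq> (\<Union>n. ?W n)"
  proof
    fix x assume "x \<in> (\<Union>i. X i)"
    then obtain i k where "x \<in> U i k" using U(1) by blast
    then have "x \<in> ?W (prod_encode (i, k))" by simp
    then show "x \<in> (\<Union>n. ?W n)" by (rule UN_I[OF UNIV_I])
  qed
  then have "hausdorff_premeasure s \<delta> (\<Union>i. X i) \<le> (\<Sum>n. diam_pow s (?W n))"
    unfolding hausdorff_premeasure_def using U(2)
    by (intro INF_lower) (simp add: split_beta)
  also have "(\<Sum>n. diam_pow s (?W n)) = (\<Sum>n. (\<lambda>(i,k). diam_pow s (U i k)) (prod_decode n))"
    by (simp add: split_beta)
  also have "\<dots> = (\<Sum>i. \<Sum>k. diam_pow s (U i k))"
    using suminf_ennreal_2dimen[of "\<lambda>i. \<Sum>k. diam_pow s (U i k)" "\<lambda>(i,k). diam_pow s (U i k)"]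
    by (simp add: comp_def)
  also have "\<dots> \<le> (\<Sum>i. hausdorff_premeasure s \<delta> (X i) + ennreal (e * (1/2) ^ Suc i))"
    by (intro suminf_le U(3)) auto
  also have "\<dots> = (\<Sum>i. hausdorff_premeasure s \<delta> (X i)) + (\<Sum>i. ennreal (e * (1/2) ^ Suc i))"
    by (rule suminf_add[symmetric]) auto
  also have "(\<Sum>i. ennreal (e * (1/2) ^ Suc i)) = ennreal e"
  proof (rule suminf_ennreal_eq)
    show "(\<lambda>i. e * (1 / 2) ^ Suc i) sums e"
      using sums_mult[OF power_half_series, of e] by simp
  qed (use e in auto)
  finally show "hausdorff_premeasure s \<delta> (\<Union>i. X i)
      \<le> (\<Sum>i. hausdorff_premeasure s \<delta> (X i)) + ennreal e" .
qed

lemma hausdorff_measure_UN_le: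
  "hausdorff_measure s (\<Union>i. X i) \<le> (\<Sum>i. hausdorff_measure s (X i))"
proof -
  have "hausdorff_premeasure s \<delta> (\<Union>i. X i) \<le> (\<Sum>i. hausdorff_measure s (X i))" if "\<delta> > 0" for \<delta>
  proof -
    have "hausdorff_premeasure s \<delta> (\<Union>i. X i) \<le> (\<Sum>i. hausdorff_premeasure s \<delta> (X i))"
      by (rule hausdorff_premeasure_UN_le)
    also have "\<dots> \<le> (\<Sum>i. hausdorff_measure s (X i))"
      unfolding hausdorff_measure_def using that by (intro suminf_le SUP_upper) auto
    finally show ?thesis .
  qed
  then show ?thesis unfolding hausdorff_measure_def[of s "\<Union>i. X i"] by (intro SUP_least) auto
qed

lemma hausdorff_measure_Un_le:
  "hausdorff_measure s (X \<union> Y) \<le> hausdorff_measure s X + hausdorff_measure s Y"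
proof -
  let ?Z = "\<lambda>i::nat. if i = 0 then X else if i = 1 then Y else {}"
  have "X \<union> Y \<subseteq> (\<Union>i. ?Z i)"
  proof
    fix x assume "x \<in> X \<union> Y"
    then consider "x \<in> ?Z 0" | "x \<in> ?Z 1" by auto
    then show "x \<in> (\<Union>i. ?Z i)" by cases (rule UN_I[OF UNIV_I], assumption)+
  qed
  then have "hausdorff_measure s (X \<union> Y) \<le> (\<Sum>i. hausdorff_measure s (?Z i))"
    by (rule order_trans[OF hausdorff_measure_mono hausdorff_measure_UN_le])
  also have "\<dots> = (\<Sum>i<2. hausdorff_measure s (?Z i))"
    by (rule suminf_finite) auto
  also have "\<dots> = hausdorff_measure s X + hausdorff_measure s Y"
    by (simp add: numeral_2_eq_2)
  finally show ?thesis .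
qed

lemma diameter_lipschitz_image_le:
  fixes f :: "'a::real_normed_vector \<Rightarrow> 'a"
  assumes "bounded U" and "0 \<le> L" and "\<And>x y. dist (f x) (f y) \<le> L * dist x y"
  shows "bounded (f ` U)" and "diameter (f ` U) \<le> L * diameter U"
proof -
  obtain D where D: "\<And>x y. x \<in> U \<Longrightarrow> y \<in> U \<Longrightarrow> dist x y \<le> D"
    using assms(1) unfolding bounded_two_points by blast
  have "dist (f x) (f y) \<le> L * D" if "x \<in> U" "y \<in> U" for x y
    using assms(3)[of x y] mult_left_mono[OF D[OF that] assms(2)] by linarith
  then show "bounded (f ` U)" unfolding bounded_two_points by blast
  show "diameter (f ` U) \<le> L * diameter U"
  proof (cases "U = {}")
    case False
    show ?thesis
    proof (rule diameter_le)
      fix x y assume "x \<in> f ` U" "y \<in> f ` U"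
      then obtain a b where ab: "a \<in> U" "b \<in> U" "x = f a" "y = f b" by auto
      have "dist x y \<le> L * dist a b" using assms(3) ab by simp
      also have "\<dots> \<le> L * diameter U"
        using diameter_bounded_bound[OF assms(1) ab(1,2)] assms(2) by (rule mult_left_mono)
      finally show "norm (x - y) \<le> L * diameter U" by (simp add: dist_norm)
    qed (use False in auto)
  qed auto
qed

text \<open>
  A cover of \<open>X\<close> is carried by \<open>f\<close> to a cover of \<open>f ` X\<close>, with diameters multiplied by \<open>L\<close> at
  most; the scale \<open>\<delta>\<close> for the image corresponds to the scale \<open>\<delta> / L\<close> for \<open>X\<close>.
\<close>

lemma hausdorff_measure_lipschitz_image_le:
  fixes f :: "'a::real_normed_vector \<Rightarrow> 'a"
  assumes L: "0 < L" and f: "\<And>x y. dist (f x) (f y) \<le> L * dist x y" and s: "0 < s"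
  shows "hausdorff_measure s (f ` X) \<le> ennreal (L powr s) * hausdorff_measure s X"
proof -
  have "hausdorff_premeasure s \<delta> (f ` X) \<le> ennreal (L powr s) * hausdorff_measure s X"
    if \<delta>: "\<delta> > 0" for \<delta>
  proof -
    have image: "hausdorff_premeasure s \<delta> (f ` X) \<le> ennreal (L powr s) * (\<Sum>i. diam_pow s (U i))"
      if U: "X \<subseteq> (\<Union>i. U i)" "\<forall>i. bounded (U i) \<and> diameter (U i) \<le> \<delta> / L" for U :: "nat \<Rightarrow> 'a set"
    proof -
      note diam = diameter_lipschitz_image_le[OF _ less_imp_le[OF L] f]
      have "f ` X \<subseteq> (\<Union>i. f ` U i)" using image_mono[OF U(1), of f] by (simp add: image_UN)
      moreover have "bounded (f ` U i)" for i using diam(1) U(2) by simp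
      moreover have "diameter (f ` U i) \<le> \<delta>" for i
      proof -
        have "diameter (f ` U i) \<le> L * diameter (U i)" using diam(2) U(2) by simp
        also have "\<dots> \<le> L * (\<delta> / L)" using U(2) L by (intro mult_left_mono) auto
        finally show ?thesis using L by simp
      qed
      ultimately have "hausdorff_premeasure s \<delta> (f ` X) \<le> (\<Sum>i. diam_pow s (f ` U i))"
        unfolding hausdorff_premeasure_def by (intro INF_lower) simp
      also have "\<dots> \<le> (\<Sum>i. ennreal (L powr s) * diam_pow s (U i))"
      proof (intro suminf_le)
        fix i
        have U_i: "bounded (U i)" using U(2) by simp
        have d: "0 \<le> diameter (f ` U i)" "0 \<le> diameter (U i)"
          using diam(1)[OF U_i] U_i by (simp_all add: diameter_ge_0)
        have "diameter (f ` U i) powr s \<le> (L * diameter (U i)) powr s"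
          using diam(2)[OF U_i] d(1) s by (intro powr_mono2) linarith+
        also have "\<dots> = L powr s * diameter (U i) powr s"
          using L d(2) by (simp add: powr_mult)
        finally have "ennreal (diameter (f ` U i) powr s)
            \<le> ennreal (L powr s) * ennreal (diameter (U i) powr s)"
          by (simp flip: ennreal_mult)
        then show "diam_pow s (f ` U i) \<le> ennreal (L powr s) * diam_pow s (U i)"
          using s by (simp add: diam_pow_def)
      qed auto
      finally show ?thesis by simp
    qed
    have "hausdorff_premeasure s \<delta> (f ` X) \<le> ennreal (L powr s) * hausdorff_premeasure s (\<delta> / L) X"
    proof -
      have ne: "ennreal (L powr s) \<noteq> 0" "ennreal (L powr s) \<noteq> top" using L by auto
      have "hausdorff_premeasure s \<delta> (f ` X) / ennreal (L powr s)
          \<le> hausdorff_premeasure s (\<delta> / L) X"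
        unfolding hausdorff_premeasure_def[of s "\<delta> / L"]
      proof (rule INF_greatest)
        fix U :: "nat \<Rightarrow> 'a set"
        assume "U \<in> {U. X \<subseteq> (\<Union>i. U i) \<and> (\<forall>i. bounded (U i) \<and> diameter (U i) \<le> \<delta> / L)}"
        then show "hausdorff_premeasure s \<delta> (f ` X) / ennreal (L powr s) \<le> (\<Sum>i. diam_pow s (U i))"
          using L by (intro divide_le_posI_ennreal image) auto
      qed
      then have "hausdorff_premeasure s \<delta> (f ` X) / ennreal (L powr s) * ennreal (L powr s)
          \<le> hausdorff_premeasure s (\<delta> / L) X * ennreal (L powr s)"
        by (rule mult_right_mono) simp
      moreover have "ennreal (L powr s) / ennreal (L powr s) = 1"
        using ne by (intro ennreal_divide_self) (auto simp: top.not_eq_extremum[symmetric])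
      then have "x / ennreal (L powr s) * ennreal (L powr s) = x" for x
        by (simp only: ennreal_divide_times mult_1_right)
      ultimately show ?thesis by (simp add: mult.commute)
    qed
    also have "\<dots> \<le> ennreal (L powr s) * hausdorff_measure s X"
      unfolding hausdorff_measure_def using \<delta> L by (intro mult_left_mono SUP_upper) auto
    finally show ?thesis .
  qed
  then show ?thesis unfolding hausdorff_measure_def[of s "f ` X"] by (intro SUP_least) auto
qed

section \<open>Optimal parametrizations from a bound on arcs\<close>

text \<open>
  The set \<open>X\<close> is covered by nonoverlapping intervals of total length close to its Lebesgue
  measure, and the bound for arcs is summed over them. Only the countable subadditivity of the
  Hausdorff measure enters, because the image of a Borel set can fail to be a Borel set.
\<close>

lemma hausdorff_measure_curve_image_le:
  fixes \<psi> :: "real \<Rightarrow> 'a::metric_space"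
  assumes c: "0 \<le> c"
    and arc: "\<And>a b. 0 \<le> a \<Longrightarrow> a \<le> b \<Longrightarrow> b \<le> 1 \<Longrightarrow> hausdorff_measure s (\<psi> ` {a..b}) \<le> ennreal (c * (b - a))"
    and X: "X \<in> lmeasurable" "X \<subseteq> {0..1}"
  shows "hausdorff_measure s (\<psi> ` X) \<le> ennreal (c * measure lebesgue X)"
proof (rule ennreal_le_epsilon)
  fix e :: real assume e: "0 < e"
  define \<eta> where "\<eta> = e / (c + 1)"
  have \<eta>: "\<eta> > 0" "c * \<eta> \<le> e" using e c by (simp_all add: \<eta>_def field_simps)
  have X_sub: "X \<subseteq> cbox 0 1" using X(2) by (simp add: cbox_interval)
  obtain \<D> where \<D>: "countable \<D>"
    "\<And>J. J \<in> \<D> \<Longrightarrow> J \<subseteq> cbox 0 1 \<and> J \<noteq> {} \<and> (\<exists>a b::real. J = cbox a b)"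
    "pairwise (\<lambda>A B. interior A \<inter> interior B = {}) \<D>"
    "X \<subseteq> \<Union>\<D>" "\<Union>\<D> \<in> lmeasurable" "measure lebesgue (\<Union>\<D>) \<le> measure lebesgue X + \<eta>"
    by (rule measurable_outer_intervals_bounded[OF X(1) X_sub \<eta>(1)]) blast
  \<comment> \<open>The intervals are enumerated without repetition; the remaining indices get the empty set.\<close>
  define J where "J i = (if i \<in> to_nat_on \<D> ` \<D> then from_nat_into \<D> i else {})" for i
  have J: "J i = {} \<or> J i \<in> \<D>" for i
    using \<D>(1) by (auto simp: J_def)
  have J_to_nat: "J (to_nat_on \<D> A) = A" if "A \<in> \<D>" for A
    using \<D>(1) that by (simp add: J_def)
  have J_le: "hausdorff_measure s (\<psi> ` J i) \<le> ennreal c * emeasure lebesgue (interior (J i))" for i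
  proof (cases "J i = {}")
    case False
    then have Ji: "J i \<subseteq> cbox 0 1 \<and> J i \<noteq> {} \<and> (\<exists>a b. J i = cbox a b)" using J \<D>(2) by blast
    then obtain a b where ab: "J i = {a..b}" by (auto simp: cbox_interval)
    have "0 \<le> a" "a \<le> b" "b \<le> 1" using Ji unfolding ab by (auto simp: cbox_interval)
    then have "hausdorff_measure s (\<psi> ` J i) \<le> ennreal (c * (b - a))"
      unfolding ab(1) by (rule arc)
    also have "\<dots> = ennreal c * emeasure lebesgue (interior (J i))"
      using c \<open>a \<le> b\<close> by (simp add: ab(1) interior_atLeastAtMost_real ennreal_mult)
    finally show ?thesis .
  qed simp
  have disj: "disjoint_family (\<lambda>i. interior (J i))"
    unfolding disjoint_family_on_def
  proof (intro ballI impI)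
    fix i k :: nat assume "i \<noteq> k"
    show "interior (J i) \<inter> interior (J k) = {}"
    proof (cases "J i = {} \<or> J k = {}")
      case False
      then have i: "J i = from_nat_into \<D> i" "i \<in> to_nat_on \<D> ` \<D>"
        and k: "J k = from_nat_into \<D> k" "k \<in> to_nat_on \<D> ` \<D>" by (auto simp: J_def split: if_splits)
      then have "J i \<noteq> J k"
        using \<open>i \<noteq> k\<close> \<D>(1) by (metis to_nat_on_from_nat_into)
      then show ?thesis using \<D>(3) J[of i] J[of k] False by (auto simp: pairwise_def)
    qed auto
  qed
  have "\<psi> ` X \<subseteq> (\<Union>i. \<psi> ` J i)"
  proof
    fix y assume "y \<in> \<psi> ` X"
    then obtain t A where t: "y = \<psi> t" "t \<in> A" "A \<in> \<D>" using \<D>(4) by blast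
    then have "y \<in> \<psi> ` J (to_nat_on \<D> A)" using J_to_nat by simp
    then show "y \<in> (\<Union>i. \<psi> ` J i)" by (rule UN_I[OF UNIV_I])
  qed
  then have "hausdorff_measure s (\<psi> ` X) \<le> (\<Sum>i. hausdorff_measure s (\<psi> ` J i))"
    by (rule order_trans[OF hausdorff_measure_mono hausdorff_measure_UN_le])
  also have "\<dots> \<le> (\<Sum>i. ennreal c * emeasure lebesgue (interior (J i)))"
    by (intro suminf_le J_le) auto
  also have "\<dots> = ennreal c * emeasure lebesgue (\<Union>i. interior (J i))"
    using disj by (subst suminf_emeasure[symmetric]) auto
  also have "\<dots> \<le> ennreal c * emeasure lebesgue (\<Union>\<D>)"
  proof (intro mult_left_mono emeasure_mono)
    show "(\<Union>i. interior (J i)) \<subseteq> \<Union>\<D>" using J interior_subset by fastforce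
  qed (use \<D>(5) in auto)
  also have "\<dots> = ennreal (c * measure lebesgue (\<Union>\<D>))"
    using c \<D>(5) by (simp add: emeasure_eq_measure2 ennreal_mult)
  also have "\<dots> \<le> ennreal (c * measure lebesgue X + e)"
  proof (rule ennreal_leI)
    have "c * measure lebesgue (\<Union>\<D>) \<le> c * (measure lebesgue X + \<eta>)"
      using c \<D>(6) by (rule mult_left_mono[rotated])
    then show "c * measure lebesgue (\<Union>\<D>) \<le> c * measure lebesgue X + e"
      using \<eta>(2) by (simp add: distrib_left)
  qed
  finally show "hausdorff_measure s (\<psi> ` X) \<le> ennreal (c * measure lebesgue X) + ennreal e"
    using c e by simp
qed

lemma holder_imp_continuous_on:
  fixes \<psi> :: "real \<Rightarrow> 'a::metric_space"
  assumes "0 < \<alpha>"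
    and "\<And>x y. x \<in> I \<Longrightarrow> y \<in> I \<Longrightarrow> dist (\<psi> x) (\<psi> y) \<le> c * \<bar>x - y\<bar> powr \<alpha>"
  shows "continuous_on I \<psi>"
proof -
  have "(\<psi> \<longlongrightarrow> \<psi> x) (at x within I)" if x: "x \<in> I" for x
  proof (rule tendsto_dist_iff[THEN iffD2], rule tendsto_sandwich[of "\<lambda>_. 0"])
    have "((\<lambda>y. \<bar>y - x\<bar> powr \<alpha>) \<longlongrightarrow> \<bar>x - x\<bar> powr \<alpha>) (at x within I)"
      using assms(1) by (intro tendsto_intros tendsto_powr') auto
    then show "((\<lambda>y. c * \<bar>y - x\<bar> powr \<alpha>) \<longlongrightarrow> 0) (at x within I)"
      by (intro tendsto_mult_right_zero) simp
    show "\<forall>\<^sub>F y in at x within I. dist (\<psi> y) (\<psi> x) \<le> c * \<bar>y - x\<bar> powr \<alpha>"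
      using assms(2) x by (auto simp: eventually_at_filter)
  qed auto
  then show ?thesis by (auto simp: continuous_on_def)
qed

lemma continuous_on_preimage_borel:
  fixes \<psi> :: "real \<Rightarrow> 'a::metric_space"
  assumes cont: "continuous_on {0..1} \<psi>" and B: "B \<in> sets borel"
  shows "{t \<in> {0..1}. \<psi> t \<in> B} \<in> sets borel"
proof -
  have "\<psi> \<in> borel_measurable (restrict_space borel {0..1})"
    using cont by (rule borel_measurable_continuous_on_restrict)
  then have "\<psi> -` B \<inter> space (restrict_space borel {0..1}) \<in> sets (restrict_space borel {0..1})"
    using B by (rule measurable_sets)
  then have "\<psi> -` B \<inter> {0..1} \<in> sets borel"
    by (subst (asm) sets_restrict_space_iff) (auto simp: space_restrict_space)
  moreover have "\<psi> -` B \<inter> {0..1} = {t \<in> {0..1}. \<psi> t \<in> B}" by auto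
  ultimately show ?thesis by simp
qed

text \<open>
  If every arc has at most its share of the measure, then so does the image of every Borel set
  (lemma \<open>hausdorff_measure_curve_image_le\<close>). The shares of \<open>X\<close> and \<open>[0, 1] - X\<close> add up to the whole
  measure, hence no image can have less than its share. Preimages of Borel sets are handled by
  applying this to the preimage. Two distinct parameters of one point can be separated by an
  interval with rational end points, and \<open>\<psi>\<close> returns to the arc over this interval only on a null set;
  so countably many null sets contain all parameters at which injectivity fails.
\<close>

lemma optimal_parametrizationI:
  fixes \<psi> :: "real \<Rightarrow> 'a::metric_space"
  assumes s: "0 < s" and onto: "\<psi> ` {0..1} = F"
    and pos: "0 < hausdorff_measure s F" and fin: "hausdorff_measure s F < \<infinity>"
    and arc: "\<And>a b. 0 \<le> a \<Longrightarrow> a \<le> b \<Longrightarrow> b \<le> 1 \<Longrightarrow>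
      hausdorff_measure s (\<psi> ` {a..b}) \<le> hausdorff_measure s F * ennreal (b - a)"
    and holder: "\<exists>c'>0. \<forall>x\<in>{0..1}. \<forall>y\<in>{0..1}. dist (\<psi> x) (\<psi> y) \<le> c' * \<bar>x - y\<bar> powr (1 / s)"
  shows "optimal_parametrization s F \<psi>"
proof -
  have cont: "continuous_on {0..1} \<psi>"
  proof -
    obtain c' where "\<And>x y. x \<in> {0..1} \<Longrightarrow> y \<in> {0..1} \<Longrightarrow> dist (\<psi> x) (\<psi> y) \<le> c' * \<bar>x - y\<bar> powr (1 / s)"
      using holder by blast
    then show ?thesis using s holder_imp_continuous_on[of "1 / s" "{0..1}" \<psi> c'] by simp
  qed
  have ne: "hausdorff_measure s F \<noteq> 0" "hausdorff_measure s F \<noteq> top" using pos fin by auto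
  obtain c where c: "hausdorff_measure s F = ennreal c" "0 < c"
    using pos fin by (cases "hausdorff_measure s F") auto
  have meas: "X \<in> lmeasurable" if "X \<in> sets borel" "X \<subseteq> {0..1}" for X :: "real set"
    using that by (intro bounded_set_imp_lmeasurable bounded_subset[OF bounded_closed_interval]) auto
  have le: "hausdorff_measure s (\<psi> ` X) \<le> ennreal (c * measure lebesgue X)"
    if "X \<in> sets borel" "X \<subseteq> {0..1}" for X
  proof (rule hausdorff_measure_curve_image_le)
    show "hausdorff_measure s (\<psi> ` {a..b}) \<le> ennreal (c * (b - a))"
      if "0 \<le> a" "a \<le> b" "b \<le> 1" for a b
      using arc[OF that] c that by (simp add: ennreal_mult)
  qed (use c meas that in auto)
  have image_eq: "hausdorff_measure s (\<psi> ` X) = hausdorff_measure s F * emeasure lebesgue X"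
    if X: "X \<in> sets borel" "X \<subseteq> {0..1}" for X
  proof -
    define m where "m = measure lebesgue X"
    have em: "emeasure lebesgue X = ennreal m"
      using meas[OF X] by (simp add: m_def emeasure_eq_measure2)
    have m0: "0 \<le> m" by (simp add: m_def)
    have "measure lebesgue ({0..1} - X) = measure lebesgue {0..1::real} - m"
      unfolding m_def using X meas[OF X] by (intro measure_Diff) (auto simp: fmeasurable_def)
    then have compl: "measure lebesgue ({0..1} - X) = 1 - m" by simp
    have m1: "m \<le> 1" using compl measure_nonneg[of lebesgue "{0..1} - X"] by linarith
    have "\<psi> ` {0..1} = \<psi> ` X \<union> \<psi> ` ({0..1} - X)" using X(2) by blast
    then have "ennreal c \<le> hausdorff_measure s (\<psi> ` X) + hausdorff_measure s (\<psi> ` ({0..1} - X))"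
      using hausdorff_measure_Un_le onto c(1) by metis
    also have "\<dots> \<le> hausdorff_measure s (\<psi> ` X) + ennreal (c * (1 - m))"
      using le[of "{0..1} - X"] X compl by (intro add_left_mono) auto
    finally have low: "ennreal c \<le> hausdorff_measure s (\<psi> ` X) + ennreal (c * (1 - m))" .
    have up: "hausdorff_measure s (\<psi> ` X) \<le> ennreal (c * m)" using le[OF X] by (simp add: m_def)
    then obtain h where h: "hausdorff_measure s (\<psi> ` X) = ennreal h" "0 \<le> h"
      by (cases "hausdorff_measure s (\<psi> ` X)") (auto simp: top_unique)
    have "c \<le> h + c * (1 - m)"
      using low h c(2) m1 by (simp flip: ennreal_plus)
    moreover have "h \<le> c * m" using up h c(2) m0 by simp
    ultimately have "h = c * m" by (simp add: algebra_simps)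
    then show ?thesis using h c em m0 by (simp add: ennreal_mult)
  qed
  have borel_preimage: "{t \<in> {0..1}. \<psi> t \<in> B} \<in> sets borel" if "B \<in> sets borel" for B
    using cont that by (rule continuous_on_preimage_borel)
  have preimage_eq: "emeasure lebesgue {t \<in> {0..1}. \<psi> t \<in> B} = hausdorff_measure s B / hausdorff_measure s F"
    if B: "B \<in> sets borel" "B \<subseteq> F" for B
  proof -
    let ?X = "{t \<in> {0..1}. \<psi> t \<in> B}"
    have sub: "?X \<subseteq> {0..1}" by auto
    have "\<psi> ` ?X = B" using B(2) onto by auto
    then have "hausdorff_measure s B = hausdorff_measure s F * emeasure lebesgue ?X"
      using image_eq[OF borel_preimage[OF B(1)] sub] by simp
    then show ?thesis
      using mult_divide_eq_ennreal[OF ne, of "emeasure lebesgue ?X"] by (simp add: mult.commute)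
  qed
  \<comment> \<open>If \<open>\<psi> x = \<psi> y\<close> and a rational interval \<open>[a, b]\<close> contains \<open>x\<close> but not \<open>y\<close>, then \<open>y \<in> R a b\<close>.\<close>
  define R where "R a b = {t \<in> {0..1}. \<psi> t \<in> \<psi> ` ({a..b} \<inter> {0..1})} - ({a..b} \<inter> {0..1})" for a b
  have image_borel: "\<psi> ` ({a..b} \<inter> {0..1}) \<in> sets borel" for a b
  proof -
    have "compact ({a..b} \<inter> {0..1})" by (simp add: compact_Int_closed)
    then have "compact (\<psi> ` ({a..b} \<inter> {0..1}))"
      by (intro compact_continuous_image continuous_on_subset[OF cont]) simp_all
    then show ?thesis by (intro borel_closed compact_imp_closed)
  qed
  have R_null: "R a b \<in> null_sets lebesgue" for a b
  proof -
    let ?P = "{a..b} \<inter> {0..1}" let ?Q = "{t \<in> {0..1}. \<psi> t \<in> \<psi> ` ({a..b} \<inter> {0..1})}"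
    have P: "?P \<in> sets borel" "?P \<subseteq> {0..1}" by auto
    have imP: "\<psi> ` ?P \<in> sets borel" by (rule image_borel)
    have imP': "\<psi> ` ?P \<subseteq> F" unfolding onto[symmetric] by (intro image_mono) simp
    have "emeasure lebesgue ?Q = hausdorff_measure s (\<psi> ` ?P) / hausdorff_measure s F"
      by (rule preimage_eq[OF imP imP'])
    also have "\<dots> = emeasure lebesgue ?P"
      using mult_divide_eq_ennreal[OF ne, of "emeasure lebesgue ?P"]
      by (subst image_eq[OF P]) (simp add: mult.commute)
    finally have eq: "emeasure lebesgue ?Q = emeasure lebesgue ?P" .
    have Q: "?Q \<in> sets lebesgue" using borel_preimage[OF imP] by simp
    have finP: "emeasure lebesgue ?P \<noteq> \<infinity>" using meas[OF P] by (auto simp: fmeasurable_def)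
    have "emeasure lebesgue (?Q - ?P) = emeasure lebesgue ?Q - emeasure lebesgue ?P"
    proof (rule emeasure_Diff[OF finP Q])
      show "?P \<in> sets lebesgue" using P(1) by simp
      show "?P \<subseteq> ?Q" by (intro subsetI CollectI conjI imageI) simp_all
    qed
    also have "\<dots> = 0" using eq finP by simp
    finally show ?thesis unfolding R_def using Q P(1)
      by (intro null_setsI sets.Diff) simp_all
  qed
  have R_borel: "R a b \<in> sets borel" for a b
    unfolding R_def by (intro sets.Diff borel_preimage image_borel) simp
  define Z where "Z = (\<Union>a\<in>\<rat>. \<Union>b\<in>\<rat>. R a b)"
  have Z_null: "Z \<in> null_sets lebesgue"
    unfolding Z_def by (intro null_sets_UN' countable_rat R_null)
  have Z_borel: "Z \<in> sets borel"
    unfolding Z_def by (intro sets.countable_UN'' countable_rat R_borel)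
  have Z_sub: "Z \<subseteq> {0..1}" by (auto simp: Z_def R_def)
  have no_revisit: "\<not> (t < t' \<and> \<psi> t = \<psi> t')" if "t \<in> {0..1} - Z" "t' \<in> {0..1} - Z" for t t'
  proof
    assume A: "t < t' \<and> \<psi> t = \<psi> t'"
    obtain b where b: "b \<in> \<rat>" "t < b" "b < t'" using Rats_dense_in_real A by blast
    obtain a where a: "a \<in> \<rat>" "a < t" using Rats_dense_in_real[of "t - 1" t] by auto
    have "t' \<in> R a b" using a b A that by (auto simp: R_def intro!: image_eqI[of _ _ t])
    then show False using that(2) a b by (auto simp: Z_def)
  qed
  have inj: "inj_on \<psi> ({0..1} - Z)"
  proof (rule inj_onI)
    fix x y assume "x \<in> {0..1} - Z" "y \<in> {0..1} - Z" "\<psi> x = \<psi> y"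
    then show "x = y" using no_revisit[of x y] no_revisit[of y x] by (cases x y rule: linorder_cases) auto
  qed
  have "hausdorff_measure s (F - \<psi> ` ({0..1} - Z)) \<le> hausdorff_measure s (\<psi> ` Z)"
    using onto by (intro hausdorff_measure_mono) auto
  also have "\<dots> = 0" using image_eq[OF Z_borel Z_sub] Z_null by (simp add: null_sets_def)
  finally have F': "hausdorff_measure s (F - \<psi> ` ({0..1} - Z)) = 0" by simp
  have bij: "\<exists>F' I'. F' \<subseteq> F \<and> hausdorff_measure s (F - F') = 0 \<and>
      I' \<subseteq> {0..1} \<and> {0..1} - I' \<in> null_sets lebesgue \<and> bij_betw \<psi> I' F'"
  proof (intro exI conjI)
    show "\<psi> ` ({0..1} - Z) \<subseteq> F" using onto by auto
    have "{0..1} - ({0..1} - Z) = Z" using Z_sub by auto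
    then show "{0..1} - ({0..1} - Z) \<in> null_sets lebesgue" using Z_null by simp
    show "bij_betw \<psi> ({0..1} - Z) (\<psi> ` ({0..1} - Z))" using inj by (rule inj_on_imp_bij_betw)
  qed (use F' in auto)
  have "compact F" using onto cont compact_continuous_image compact_Icc by metis
  with pos fin onto bij image_eq preimage_eq holder show ?thesis
    unfolding optimal_parametrization_def by blast
qed

section \<open>Hausdorff measure of Hoelder curves\<close>

lemma diam_pow_le:
  assumes "0 < t" "bounded U" "diameter U \<le> b"
  shows "diam_pow t U \<le> ennreal (b powr t)"
  using assms by (auto simp: diam_pow_def diameter_ge_0 intro!: ennreal_leI powr_mono2)

lemma hausdorff_premeasure_antimono:
  "\<delta> \<le> \<delta>' \<Longrightarrow> hausdorff_premeasure s \<delta>' X \<le> hausdorff_premeasure s \<delta> X"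
  unfolding hausdorff_premeasure_def by (rule INF_superset_mono) (auto intro: order_trans)

text \<open>
  The unit interval is cut into \<open>n\<close> equal parts, whose images have diameter at most
  \<open>C n\<^sup>-\<^sup>1\<^sup>/\<^sup>s\<close>.
\<close>

lemma hausdorff_premeasure_holder_curve_le:
  fixes \<psi> :: "real \<Rightarrow> 'a::real_normed_vector"
  assumes s: "0 < s" and t: "0 < t" and C: "0 < C" and n: "0 < n"
    and holder: "\<And>x y. x \<in> {0..1} \<Longrightarrow> y \<in> {0..1} \<Longrightarrow> dist (\<psi> x) (\<psi> y) \<le> C * \<bar>x - y\<bar> powr (1 / s)"
  shows "hausdorff_premeasure t (C * real n powr (- (1 / s))) (\<psi> ` {0..1})
      \<le> ennreal (C powr t * real n powr (1 - t / s))"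
proof -
  let ?b = "C * real n powr (- (1 / s))"
  let ?I = "\<lambda>i. {real i / real n..real (Suc i) / real n}"
  have I_sub: "?I i \<subseteq> {0..1}" if "i < n" for i
  proof -
    have "real (Suc i) / real n \<le> 1" using that by (simp add: divide_le_eq)
    then show ?thesis by auto
  qed
  have dist_le: "dist p q \<le> ?b" if i: "i < n" and pq: "p \<in> \<psi> ` ?I i" "q \<in> \<psi> ` ?I i" for i p q
  proof -
    obtain x y where xy: "x \<in> ?I i" "y \<in> ?I i" "p = \<psi> x" "q = \<psi> y" using pq by blast
    have "\<bar>x - y\<bar> \<le> 1 / real n" using xy(1,2) by (auto simp: add_divide_distrib)
    then have "\<bar>x - y\<bar> powr (1 / s) \<le> (1 / real n) powr (1 / s)" using s by (intro powr_mono2) auto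
    also have "\<dots> = real n powr (- (1 / s))" by (simp add: powr_minus_divide powr_divide)
    finally have "C * \<bar>x - y\<bar> powr (1 / s) \<le> ?b" using C by (intro mult_left_mono) auto
    moreover have "x \<in> {0..1}" "y \<in> {0..1}" using subsetD[OF I_sub[OF i]] xy(1,2) by blast+
    then have "dist p q \<le> C * \<bar>x - y\<bar> powr (1 / s)" using holder[of x y] xy(3,4) by simp
    ultimately show ?thesis by simp
  qed
  have cover: "\<psi> ` {0..1} \<subseteq> (\<Union>i<n. \<psi> ` ?I i)"
  proof
    fix p assume "p \<in> \<psi> ` {0..1}"
    then obtain x where x: "x \<in> {0..1}" "p = \<psi> x" by blast
    \<comment> \<open>The minimum puts \<open>x = 1\<close> into the last interval.\<close>
    define i where "i = min (nat \<lfloor>x * real n\<rfloor>) (n - 1)"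
    have "i < n" using n by (auto simp: i_def)
    moreover have "x \<in> ?I i"
    proof (cases "x = 1")
      case True
      then have "i = n - 1" by (simp add: i_def)
      then show ?thesis using True n by (simp add: divide_le_eq le_divide_eq of_nat_diff)
    next
      case False
      then have "x * real n < real n" "0 \<le> x * real n" using x n by auto
      then have "nat \<lfloor>x * real n\<rfloor> < n" by linarith
      then have "i = nat \<lfloor>x * real n\<rfloor>" by (simp add: i_def)
      then have "real i \<le> x * real n" "x * real n \<le> real (Suc i)"
        using \<open>0 \<le> x * real n\<close> by linarith+
      then show ?thesis using n by (simp add: field_simps)
    qed
    ultimately show "p \<in> (\<Union>i<n. \<psi> ` ?I i)" using x(2) by blast
  qed
  have b: "0 \<le> ?b" using C by simp
  have bdd: "bounded (\<psi> ` ?I i)" if "i < n" for i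
    using dist_le[OF that] unfolding bounded_two_points by blast
  have diam: "diameter (\<psi> ` ?I i) \<le> ?b" if "i < n" for i
    using dist_le[OF that] b by (intro diameter_le) (auto simp: dist_norm)
  have "hausdorff_premeasure t ?b (\<psi> ` {0..1}) \<le> (\<Sum>i<n. diam_pow t (\<psi> ` ?I i))"
    using bdd diam b by (intro hausdorff_premeasure_le_finite_cover cover conjI) simp_all
  also have "\<dots> \<le> (\<Sum>i<n. ennreal (?b powr t))"
    using bdd diam t by (intro sum_mono diam_pow_le) simp_all
  also have "\<dots> = ennreal (real n * ?b powr t)"
    by (simp add: ennreal_mult ennreal_of_nat_eq_real_of_nat)
  also have "real n * ?b powr t = C powr t * real n powr (1 - t / s)"
  proof -
    have "?b powr t = C powr t * real n powr (- (t / s))"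
      using C by (simp add: powr_mult powr_powr)
    moreover have "real n * real n powr (- (t / s)) = real n powr (1 - t / s)"
      using n by (simp add: powr_diff powr_minus_divide)
    ultimately show ?thesis by (simp add: mult_ac)
  qed
  finally show ?thesis .
qed

lemma hausdorff_measure_holder_curve_le:
  fixes \<psi> :: "real \<Rightarrow> 'a::real_normed_vector"
  assumes s: "0 < s" and t: "0 < t" and C: "0 < C"
    and holder: "\<And>x y. x \<in> {0..1} \<Longrightarrow> y \<in> {0..1} \<Longrightarrow> dist (\<psi> x) (\<psi> y) \<le> C * \<bar>x - y\<bar> powr (1 / s)"
    and lim: "(\<lambda>n. C powr t * real n powr (1 - t / s)) \<longlonglongrightarrow> L"
  shows "hausdorff_measure t (\<psi> ` {0..1}) \<le> ennreal L"
proof -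
  have "hausdorff_premeasure t \<delta> (\<psi> ` {0..1}) \<le> ennreal L" if \<delta>: "0 < \<delta>" for \<delta>
  proof (rule tendsto_lowerbound)
    show "(\<lambda>n. ennreal (C powr t * real n powr (1 - t / s))) \<longlonglongrightarrow> ennreal L"
      using lim by (rule tendsto_ennrealI)
    have "(\<lambda>n. C * real n powr (- (1 / s))) \<longlonglongrightarrow> C * 0"
      using s by (intro tendsto_mult tendsto_const tendsto_neg_powr filterlim_real_sequentially) auto
    then have "\<forall>\<^sub>F n in sequentially. C * real n powr (- (1 / s)) < \<delta>"
      using \<delta> by (intro order_tendstoD) auto
    then show "\<forall>\<^sub>F n in sequentially. hausdorff_premeasure t \<delta> (\<psi> ` {0..1})
        \<le> ennreal (C powr t * real n powr (1 - t / s))"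
      using eventually_gt_at_top[of 0]
    proof eventually_elim
      case (elim n)
      have "hausdorff_premeasure t \<delta> (\<psi> ` {0..1})
          \<le> hausdorff_premeasure t (C * real n powr (- (1 / s))) (\<psi> ` {0..1})"
        using elim(1) by (intro hausdorff_premeasure_antimono) simp
      also have "\<dots> \<le> ennreal (C powr t * real n powr (1 - t / s))"
        by (rule hausdorff_premeasure_holder_curve_le[OF s t C elim(2) holder])
      finally show ?case .
    qed
  qed simp
  then show ?thesis unfolding hausdorff_measure_def by (intro SUP_least) simp
qed

lemma hausdorff_measure_holder_curve_finite:
  fixes \<psi> :: "real \<Rightarrow> 'a::real_normed_vector"
  assumes s: "0 < s" and C: "0 < C"
    and holder: "\<And>x y. x \<in> {0..1} \<Longrightarrow> y \<in> {0..1} \<Longrightarrow> dist (\<psi> x) (\<psi> y) \<le> C * \<bar>x - y\<bar> powr (1 / s)"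
  shows "hausdorff_measure s (\<psi> ` {0..1}) < \<infinity>"
proof -
  have "\<forall>\<^sub>F n in sequentially. C powr s * real n powr (1 - s / s) = C powr s"
    using eventually_gt_at_top[of 0] by eventually_elim (use s in simp)
  then have "(\<lambda>n. C powr s * real n powr (1 - s / s)) \<longlonglongrightarrow> C powr s"
    by (rule tendsto_eventually)
  from hausdorff_measure_holder_curve_le[OF s s C holder this]
  show ?thesis by (rule order_le_less_trans) auto
qed

lemma hausdorff_measure_holder_curve_zero:
  fixes \<psi> :: "real \<Rightarrow> 'a::real_normed_vector"
  assumes s: "0 < s" and t: "s < t" and C: "0 < C"
    and holder: "\<And>x y. x \<in> {0..1} \<Longrightarrow> y \<in> {0..1} \<Longrightarrow> dist (\<psi> x) (\<psi> y) \<le> C * \<bar>x - y\<bar> powr (1 / s)"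
  shows "hausdorff_measure t (\<psi> ` {0..1}) = 0"
proof -
  have "(\<lambda>n. C powr t * real n powr (1 - t / s)) \<longlonglongrightarrow> C powr t * 0"
    using s t by (intro tendsto_mult tendsto_const tendsto_neg_powr filterlim_real_sequentially) auto
  then have "(\<lambda>n. C powr t * real n powr (1 - t / s)) \<longlonglongrightarrow> 0" by simp
  from hausdorff_measure_holder_curve_le[OF s less_trans[OF s t] C holder this]
  show ?thesis by simp
qed

section \<open>Volume under similitudes\<close>

text \<open>
  A similitude is affine and injective, hence onto, because the domain has finite dimension.
\<close>

lemma similitude_image_ball:
  fixes f :: "'a::euclidean_space \<Rightarrow> 'a"
  assumes r: "0 < r" and f: "\<And>x y. dist (f x) (f y) = r * dist x y"
  shows "f ` ball x \<rho> = ball (f x) (r * \<rho>)"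
proof -
  have "linear (\<lambda>x. f x - f 0)"
    using f by (intro scaling_linear[of _ r]) (simp_all add: dist_norm)
  moreover have "inj (\<lambda>x. f x - f 0)"
    using f r by (intro injI) (metis diff_add_cancel dist_eq_0_iff mult_eq_0_iff less_irrefl)
  ultimately have surj: "surj (\<lambda>x. f x - f 0)" by (rule linear_injective_imp_surjective) simp
  show ?thesis
  proof
    show "f ` ball x \<rho> \<subseteq> ball (f x) (r * \<rho>)" using f r by auto
    show "ball (f x) (r * \<rho>) \<subseteq> f ` ball x \<rho>"
    proof
      fix y assume y: "y \<in> ball (f x) (r * \<rho>)"
      obtain z where "y - f 0 = f z - f 0" using surjD[OF surj, of "y - f 0"] by blast
      then have z: "y = f z" by simp
      then have "z \<in> ball x \<rho>" using y r f by simp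
      then show "y \<in> f ` ball x \<rho>" using z by blast
    qed
  qed
qed

lemma similitude_image_open:
  fixes f :: "'a::euclidean_space \<Rightarrow> 'a"
  assumes r: "0 < r" and f: "\<And>x y. dist (f x) (f y) = r * dist x y" and G: "open G"
  shows "open (f ` G)"
  unfolding open_contains_ball
proof
  fix y assume "y \<in> f ` G"
  then obtain x where x: "x \<in> G" "y = f x" by blast
  then obtain \<rho> where "\<rho> > 0" "ball x \<rho> \<subseteq> G" using G open_contains_ball by blast
  then have "ball y (r * \<rho>) \<subseteq> f ` G" "r * \<rho> > 0"
    using similitude_image_ball[OF r f, of x \<rho>] image_mono[of "ball x \<rho>" G f] x r by simp_all
  then show "\<exists>e>0. ball y e \<subseteq> f ` G" by blast
qed

text \<open>
  By Vitali's theorem \<open>G\<close> is, up to a null set, a disjoint union of balls; a similitude maps these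
  to disjoint balls with radii scaled by \<open>r\<close>.
\<close>

lemma similitude_volume_ge:
  fixes f :: "'a::euclidean_space \<Rightarrow> 'a"
  assumes r: "0 < r" and f: "\<And>x y. dist (f x) (f y) = r * dist x y" and G: "open G"
  shows "ennreal (r ^ DIM('a)) * emeasure lborel G \<le> emeasure lborel (f ` G)"
proof -
  define B where "B = {(x, \<rho>). 0 < \<rho> \<and> ball x \<rho> \<subseteq> G}"
  have fine: "\<exists>i. i \<in> B \<and> x \<in> ball (fst i) (snd i) \<and> snd i < d" if x: "x \<in> G" and d: "0 < d" for x d
  proof -
    obtain \<rho> where \<rho>: "\<rho> > 0" "ball x \<rho> \<subseteq> G" using G x open_contains_ball by blast
    then have "(x, min \<rho> (d / 2)) \<in> B" using d by (auto simp: B_def)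
    then show ?thesis using \<rho> d by (intro exI[of _ "(x, min \<rho> (d / 2))"]) auto
  qed
  obtain C where C: "countable C" "C \<subseteq> B"
    "pairwise (\<lambda>i j. disjnt (ball (fst i) (snd i)) (ball (fst j) (snd j))) C"
    "negligible (G - (\<Union>i\<in>C. ball (fst i) (snd i)))"
    by (rule Vitali_covering_theorem_balls[OF fine]) blast
  let ?b = "\<lambda>i. ball (fst i) (snd i)"
  have disj: "disjoint_family_on ?b C"
    using C(3) by (auto simp: disjoint_family_on_def pairwise_def disjnt_def)
  have inj: "inj f"
    using f r by (intro injI) (metis dist_eq_0_iff mult_eq_0_iff less_irrefl)
  have image: "f ` ?b i = ball (f (fst i)) (r * snd i)" for i
    by (rule similitude_image_ball[OF r f])
  have disj': "disjoint_family_on (\<lambda>i. f ` ?b i) C"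
    using disj inj unfolding disjoint_family_on_def by (metis image_Int image_empty)
  have scale: "ennreal (r ^ DIM('a)) * emeasure lborel (?b i) = emeasure lborel (f ` ?b i)"
    if "i \<in> C" for i
  proof -
    have "0 \<le> snd i" using that C(2) by (auto simp: B_def)
    then show ?thesis
      using r by (simp add: image emeasure_ball power_mult_distrib mult_ac flip: ennreal_mult)
  qed
  have rest: "G - (\<Union>i\<in>C. ?b i) \<in> sets lborel"
  proof (rule sets.Diff)
    show "G \<in> sets lborel" using G by simp
    show balls: "(\<Union>i\<in>C. ?b i) \<in> sets lborel" by (simp add: borel_open open_UN)
  qed
  then have "G - (\<Union>i\<in>C. ?b i) \<in> null_sets lborel"
    using C(4) null_sets_completion_iff[OF rest] by (simp add: negligible_iff_null_sets)
  then have null: "emeasure lborel (G - (\<Union>i\<in>C. ?b i)) = 0" by (simp add: null_sets_def)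
  have balls: "(\<Union>i\<in>C. ?b i) \<in> sets lborel" by (simp add: borel_open open_UN)
  have "emeasure lborel G \<le> emeasure lborel ((G - (\<Union>i\<in>C. ?b i)) \<union> (\<Union>i\<in>C. ?b i))"
    by (rule emeasure_mono[OF _ sets.Un[OF rest balls]]) blast
  also have "\<dots> \<le> emeasure lborel (G - (\<Union>i\<in>C. ?b i)) + emeasure lborel (\<Union>i\<in>C. ?b i)"
    by (rule emeasure_subadditive[OF rest balls])
  finally have "emeasure lborel G \<le> emeasure lborel (\<Union>i\<in>C. ?b i)" using null by simp
  also have "\<dots> = (\<integral>\<^sup>+i. emeasure lborel (?b i) \<partial>count_space C)"
    using C(1) disj by (intro emeasure_UN_countable) auto
  finally have "ennreal (r ^ DIM('a)) * emeasure lborel G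
      \<le> ennreal (r ^ DIM('a)) * (\<integral>\<^sup>+i. emeasure lborel (?b i) \<partial>count_space C)"
    by (rule mult_left_mono) simp
  also have "\<dots> = (\<integral>\<^sup>+i. ennreal (r ^ DIM('a)) * emeasure lborel (?b i) \<partial>count_space C)"
    by (rule nn_integral_cmult[symmetric]) simp
  also have "\<dots> = (\<integral>\<^sup>+i. emeasure lborel (f ` ?b i) \<partial>count_space C)"
    by (intro nn_integral_cong) (simp add: scale)
  also have "\<dots> = emeasure lborel (\<Union>i\<in>C. f ` ?b i)"
    using C(1) disj' image by (intro emeasure_UN_countable[symmetric]) auto
  also have "\<dots> \<le> emeasure lborel (f ` G)"
  proof (rule emeasure_mono)
    have "?b i \<subseteq> G" if "i \<in> C" for i
      using subsetD[OF C(2) that] unfolding B_def by (simp add: split_beta)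
    then show "(\<Union>i\<in>C. f ` ?b i) \<subseteq> f ` G" by (intro UN_least image_mono)
    show "f ` G \<in> sets lborel" using similitude_image_open[OF r f G] by simp
  qed
  finally show ?thesis .
qed

section \<open>The curves of a substitution by traveling trails\<close>

text \<open>
  The combinatorial content of a substitution by traveling trails. The \<open>k\<close>-th edge of the trail
  \<open>P\<^sub>u\<close> (counted from \<open>0\<close>) is the copy under \<open>S (idx u k)\<close> of the edge \<open>edge u k\<close>; that each \<open>P\<^sub>u\<close> is
  traveling is expressed by the bijectivity of \<open>idx u\<close>.
\<close>

locale traveling_substitution =
  fixes S :: "nat \<Rightarrow> 'a::euclidean_space \<Rightarrow> 'a" and N :: nat and r :: "nat \<Rightarrow> real" and s :: real
    and K :: "'a set" and V :: "'b set" and origin terminus :: "'b \<Rightarrow> 'a"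
    and edge :: "'b \<Rightarrow> nat \<Rightarrow> 'b" and idx :: "'b \<Rightarrow> nat \<Rightarrow> nat"
  assumes N: "0 < N"
    and ratio: "j \<in> {1..N} \<Longrightarrow> 0 < r j" "j \<in> {1..N} \<Longrightarrow> r j < 1"
    and similitude: "j \<in> {1..N} \<Longrightarrow> dist (S j x) (S j y) = r j * dist x y"
    and s_pos: "0 < s" and moran: "(\<Sum>j=1..N. r j powr s) = 1"
    and K: "invariant_set N S K"
    and ends_in_K: "u \<in> V \<Longrightarrow> origin u \<in> K" "u \<in> V \<Longrightarrow> terminus u \<in> K"
    and edge: "u \<in> V \<Longrightarrow> k < N \<Longrightarrow> edge u k \<in> V"
    and idx: "u \<in> V \<Longrightarrow> bij_betw (idx u) {..<N} {1..N}"
    and first: "u \<in> V \<Longrightarrow> S (idx u 0) (origin (edge u 0)) = origin u"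
    and last: "u \<in> V \<Longrightarrow> S (idx u (N - 1)) (terminus (edge u (N - 1))) = terminus u"
    and consecutive: "u \<in> V \<Longrightarrow> Suc k < N \<Longrightarrow>
      S (idx u k) (terminus (edge u k)) = S (idx u (Suc k)) (origin (edge u (Suc k)))"
begin

definition weight :: "'b \<Rightarrow> nat \<Rightarrow> real" where
  "weight u k = r (idx u k) powr s"

text \<open>
  The end points of the cells: the \<open>k\<close>-th cell of \<open>u\<close> is the interval from \<open>mark u k\<close> to
  \<open>mark u (Suc k)\<close>.
\<close>

definition mark :: "'b \<Rightarrow> nat \<Rightarrow> real" where
  "mark u k = (\<Sum>i<k. weight u i)"

definition rmax :: real where "rmax = Max (r ` {1..N})"

definition rmin :: real where "rmin = Min (r ` {1..N})"

lemma rmax: "0 < rmax" "rmax < 1" "j \<in> {1..N} \<Longrightarrow> r j \<le> rmax"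
proof -
  have fin: "finite (r ` {1..N})" "r ` {1..N} \<noteq> {}" using N by auto
  show "rmax < 1" unfolding rmax_def using fin ratio(2) by (subst Max_less_iff) auto
  show le: "r j \<le> rmax" if "j \<in> {1..N}" for j unfolding rmax_def using fin that by auto
  show "0 < rmax" using le[of 1] ratio(1)[of 1] N by auto
qed

lemma rmin: "0 < rmin" "rmin < 1" "j \<in> {1..N} \<Longrightarrow> rmin \<le> r j"
proof -
  have fin: "finite (r ` {1..N})" "r ` {1..N} \<noteq> {}" using N by auto
  show "0 < rmin" unfolding rmin_def using fin ratio(1) by (subst Min_gr_iff) auto
  show le: "rmin \<le> r j" if "j \<in> {1..N}" for j unfolding rmin_def using fin that by auto
  show "rmin < 1" using le[of 1] ratio(2)[of 1] N by auto
qed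

lemma idx_range: "u \<in> V \<Longrightarrow> k < N \<Longrightarrow> idx u k \<in> {1..N}"
  using idx[of u] by (auto simp: bij_betw_def)

lemma weight_bounds:
  assumes "u \<in> V" "k < N"
  shows "0 < weight u k" "weight u k < 1" "rmin powr s \<le> weight u k" "weight u k \<le> rmax powr s"
proof -
  note j = idx_range[OF assms]
  show "0 < weight u k" using ratio(1)[OF j] by (simp add: weight_def)
  show "weight u k < 1" unfolding weight_def
    using powr_less_mono2[of s "r (idx u k)" 1] ratio[OF j] s_pos by simp
  show "rmin powr s \<le> weight u k" "weight u k \<le> rmax powr s" unfolding weight_def
    using rmin(1) rmin(3)[OF j] rmax(3)[OF j] ratio(1)[OF j] s_pos by (auto intro!: powr_mono2)
qed

lemma mark_0 [simp]: "mark u 0 = 0" by (simp add: mark_def)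

lemma mark_Suc: "mark u (Suc k) = mark u k + weight u k" by (simp add: mark_def)

lemma mark_N: "u \<in> V \<Longrightarrow> mark u N = 1"
  using sum.reindex_bij_betw[OF idx, of u "\<lambda>j. r j powr s"] moran
  by (simp add: mark_def weight_def)

lemma mark_less: "u \<in> V \<Longrightarrow> i < k \<Longrightarrow> k \<le> N \<Longrightarrow> mark u i < mark u k"
proof (induction k)
  case (Suc k)
  then show ?case using weight_bounds(1)[of u k] by (cases "i = k") (auto simp: mark_Suc)
qed simp

lemma mark_le: "u \<in> V \<Longrightarrow> i \<le> k \<Longrightarrow> k \<le> N \<Longrightarrow> mark u i \<le> mark u k"
  using mark_less[of u i k] by (cases "i = k") auto

lemma mark_range:
  assumes "u \<in> V" "k \<le> N" shows "0 \<le> mark u k" "mark u k \<le> 1"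
  using mark_le[of u 0 k] mark_le[of u k N] mark_N assms by auto

lemma cell_range:
  assumes "u \<in> V" "k < N" "t \<in> {0..1}"
  shows "mark u k + weight u k * t \<in> {0..1}"
proof -
  have w: "0 < weight u k" using weight_bounds(1)[OF assms(1,2)] .
  have "weight u k * t \<le> weight u k * 1" "0 \<le> weight u k * t"
    using w assms(3) by (auto intro!: mult_left_mono)
  then show ?thesis
    using mark_range[of u k] mark_range[of u "Suc k"] assms by (auto simp: mark_Suc)
qed

definition cell :: "'b \<Rightarrow> real \<Rightarrow> nat" where
  "cell u t = (LEAST k. t \<le> mark u (Suc k))"

lemma cell:
  assumes u: "u \<in> V" and t: "t \<in> {0..1}"
  shows "cell u t < N" "mark u (cell u t) \<le> t" "t \<le> mark u (Suc (cell u t))"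
proof -
  have last: "t \<le> mark u (Suc (N - 1))" using mark_N[OF u] N t by simp
  then show le: "t \<le> mark u (Suc (cell u t))" unfolding cell_def by (rule LeastI)
  have "cell u t \<le> N - 1" unfolding cell_def using last by (rule Least_le)
  then show "cell u t < N" using N by simp
  show "mark u (cell u t) \<le> t"
  proof (cases "cell u t")
    case (Suc i)
    then have "\<not> t \<le> mark u (Suc i)" using not_less_Least[of i "\<lambda>k. t \<le> mark u (Suc k)"]
      by (simp add: cell_def)
    then show ?thesis using Suc by simp
  qed (use t in simp)
qed

lemma cell_coordinate:
  assumes u: "u \<in> V" and k: "k < N" and t: "mark u k \<le> t" "t \<le> mark u (Suc k)"
  shows "(t - mark u k) / weight u k \<in> {0..1}"
    and "t = mark u k + weight u k * ((t - mark u k) / weight u k)"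
  using weight_bounds(1)[OF u k] t by (auto simp: mark_Suc divide_simps)

lemma cell_cases:
  assumes u: "u \<in> V" and t: "t \<in> {0..1}"
  obtains k t' where "k < N" "t' \<in> {0..1}" "t = mark u k + weight u k * t'"
  using cell[OF assms] cell_coordinate[OF u, of "cell u t" t] by blast

lemma cell_interior:
  assumes u: "u \<in> V" and k: "k < N" and t: "mark u k < t" "t \<le> mark u (Suc k)"
  shows "cell u t = k"
  unfolding cell_def
proof (rule Least_equality)
  fix i assume "t \<le> mark u (Suc i)"
  then show "k \<le> i" using mark_le[OF u, of "Suc i" k] k t(1) by (rule_tac ccontr) auto
qed (use t in auto)

lemma cell_zero: "u \<in> V \<Longrightarrow> cell u 0 = 0"
  unfolding cell_def using mark_range[of u "Suc 0"] N by (intro Least_equality) auto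

text \<open>
  The start of the iteration is discontinuous, but it has the right end points, and these are all
  that matters for the pieces to fit together.
\<close>

primrec approx :: "nat \<Rightarrow> 'b \<Rightarrow> real \<Rightarrow> 'a" where
  "approx 0 = (\<lambda>u t. if t = 0 then origin u else terminus u)"
| "approx (Suc n) = (\<lambda>u t. S (idx u (cell u t))
      (approx n (edge u (cell u t)) ((t - mark u (cell u t)) / weight u (cell u t))))"

lemma approx_interior:
  assumes u: "u \<in> V" and k: "k < N" and t: "0 < t" "t \<le> 1"
  shows "approx (Suc n) u (mark u k + weight u k * t) = S (idx u k) (approx n (edge u k) t)"
proof -
  have w: "0 < weight u k" by (rule weight_bounds(1)[OF u k])
  have "cell u (mark u k + weight u k * t) = k"
    using w t by (intro cell_interior[OF u k]) (auto simp: mark_Suc)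
  then show ?thesis using w by simp
qed

lemma approx_ends:
  "u \<in> V \<Longrightarrow> approx n u 0 = origin u \<and> approx n u 1 = terminus u"
proof (induction n arbitrary: u)
  case (Suc n)
  have "approx (Suc n) u 0 = origin u"
    using Suc.IH[OF edge[OF Suc.prems N]] first[OF Suc.prems] cell_zero[OF Suc.prems] by simp
  moreover have "mark u (N - 1) + weight u (N - 1) * 1 = 1"
    using mark_N[OF Suc.prems] mark_Suc[of u "N - 1"] N by simp
  then have "approx (Suc n) u 1 = S (idx u (N - 1)) (approx n (edge u (N - 1)) 1)"
    using approx_interior[OF Suc.prems, of "N - 1" 1 n] N by simp
  then have "approx (Suc n) u 1 = terminus u"
    using Suc.IH[OF edge[OF Suc.prems, of "N - 1"]] last[OF Suc.prems] N by simp
  ultimately show ?case by blast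
qed simp

text \<open>
  At a mark the least cell is chosen, so the value comes from the terminus of the preceding cell;
  it is also the value at the origin of the next cell because the trail is connected.
\<close>

lemma approx_cell:
  assumes u: "u \<in> V" and k: "k < N" and t: "t \<in> {0..1}"
  shows "approx (Suc n) u (mark u k + weight u k * t) = S (idx u k) (approx n (edge u k) t)"
proof (cases "t = 0")
  case False
  then show ?thesis using approx_interior[OF u k] t by simp
next
  case True
  note ends = approx_ends[OF edge[OF u]]
  show ?thesis
  proof (cases k)
    case 0
    then show ?thesis using True cell_zero[OF u] by simp
  next
    case (Suc i)
    have "approx (Suc n) u (mark u k + weight u k * t) = approx (Suc n) u (mark u i + weight u i * 1)"
      using True Suc by (simp add: mark_Suc)
    also have "\<dots> = S (idx u i) (approx n (edge u i) 1)"
      using k Suc by (intro approx_interior[OF u]) auto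
    also have "\<dots> = S (idx u k) (approx n (edge u k) 0)"
      using consecutive[OF u, of i] ends[of i n] ends[of k n] k Suc by simp
    finally show ?thesis using True by simp
  qed
qed

lemma S_in_K: "j \<in> {1..N} \<Longrightarrow> x \<in> K \<Longrightarrow> S j x \<in> K"
  using K unfolding invariant_set_def by blast

lemma compact_K: "compact K" and K_nonempty: "K \<noteq> {}" and K_eq: "K = (\<Union>j\<in>{1..N}. S j ` K)"
  using K unfolding invariant_set_def by auto

lemma approx_in_K: "u \<in> V \<Longrightarrow> t \<in> {0..1} \<Longrightarrow> approx n u t \<in> K"
proof (induction n arbitrary: u t)
  case 0
  then show ?case using ends_in_K by simp
next
  case (Suc n)
  obtain k t' where kt: "k < N" "t' \<in> {0..1}" "t = mark u k + weight u k * t'"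
    using cell_cases[OF Suc.prems] by blast
  then show ?case
    using approx_cell[OF Suc.prems(1) kt(1,2)] Suc.IH[OF edge[OF Suc.prems(1) kt(1)] kt(2)]
      S_in_K[OF idx_range[OF Suc.prems(1) kt(1)]] by metis
qed

lemma K_dist_bound:
  obtains D where "0 < D" "\<forall>x\<in>K. \<forall>y\<in>K. dist x y \<le> D"
proof -
  obtain D where D: "\<forall>x\<in>K. \<forall>y\<in>K. dist x y \<le> D"
    using compact_imp_bounded[OF compact_K] unfolding bounded_two_points by blast
  show thesis
  proof (rule that)
    show "0 < max D 1" by simp
    show "\<forall>x\<in>K. \<forall>y\<in>K. dist x y \<le> max D 1" using D by (simp add: le_max_iff_disj)
  qed
qed

lemma approx_step:
  assumes D: "\<forall>x\<in>K. \<forall>y\<in>K. dist x y \<le> D"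
  shows "u \<in> V \<Longrightarrow> t \<in> {0..1} \<Longrightarrow> dist (approx n u t) (approx (Suc n) u t) \<le> D * rmax ^ n"
proof (induction n arbitrary: u t)
  case 0
  show ?case using D approx_in_K[OF 0, of 0] approx_in_K[OF 0, of "Suc 0"] by simp
next
  case (Suc n)
  obtain k t' where kt: "k < N" "t' \<in> {0..1}" "t = mark u k + weight u k * t'"
    using cell_cases[OF Suc.prems] by blast
  note j = idx_range[OF Suc.prems(1) kt(1)]
  have "dist (approx (Suc n) u t) (approx (Suc (Suc n)) u t)
      = r (idx u k) * dist (approx n (edge u k) t') (approx (Suc n) (edge u k) t')"
    unfolding kt(3) approx_cell[OF Suc.prems(1) kt(1,2)] by (rule similitude[OF j])
  also have "\<dots> \<le> rmax * (D * rmax ^ n)"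
    using Suc.IH[OF edge[OF Suc.prems(1) kt(1)] kt(2)] rmax(3)[OF j] rmax(1)
    by (intro mult_mono) auto
  finally show ?case by (simp add: mult_ac)
qed

definition curve :: "'b \<Rightarrow> real \<Rightarrow> 'a" where
  "curve u t = lim (\<lambda>n. approx n u t)"

lemma approx_tendsto_curve:
  assumes u: "u \<in> V" and t: "t \<in> {0..1}"
  shows "(\<lambda>n. approx n u t) \<longlonglongrightarrow> curve u t"
proof -
  obtain D where D: "0 < D" "\<forall>x\<in>K. \<forall>y\<in>K. dist x y \<le> D" using K_dist_bound by blast
  have "summable (\<lambda>n. D * rmax ^ n)"
    using rmax by (intro summable_mult summable_geometric) auto
  moreover have "norm (approx (Suc n) u t - approx n u t) \<le> D * rmax ^ n" for n
    using approx_step[OF D(2) u t, of n] unfolding dist_norm by (simp only: norm_minus_commute)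
  ultimately have "summable (\<lambda>n. approx (Suc n) u t - approx n u t)"
    by (rule summable_comparison_test'[where N = 0])
  then have "convergent (\<lambda>n. (\<Sum>i<n. approx (Suc i) u t - approx i u t) + approx 0 u t)"
    by (intro convergent_add convergent_const) (simp add: summable_iff_convergent)
  then have "convergent (\<lambda>n. approx n u t)"
    by (simp only: sum_lessThan_telescope[of "\<lambda>n. approx n u t"] diff_add_cancel)
  then show ?thesis unfolding curve_def by (simp add: convergent_LIMSEQ_iff)
qed

lemma curve_in_K: "u \<in> V \<Longrightarrow> t \<in> {0..1} \<Longrightarrow> curve u t \<in> K"
  by (rule Lim_in_closed_set[OF compact_imp_closed[OF compact_K] _ _ approx_tendsto_curve])
    (auto intro!: always_eventually approx_in_K)

lemma curve_ends:
  assumes "u \<in> V" shows "curve u 0 = origin u" "curve u 1 = terminus u"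
  using approx_ends[OF assms] by (simp_all add: curve_def)

lemma S_continuous: "j \<in> {1..N} \<Longrightarrow> continuous_on UNIV (S j)"
  by (rule lipschitz_on_continuous_on[of "r j"])
    (auto intro!: lipschitz_onI simp: similitude ratio less_imp_le)

text \<open>
  The self-similarity of the curves. All further properties of them are derived from this equation
  and from the fact that the curves stay in \<open>K\<close>.
\<close>

lemma curve_cell:
  assumes u: "u \<in> V" and k: "k < N" and t: "t \<in> {0..1}"
  shows "curve u (mark u k + weight u k * t) = S (idx u k) (curve (edge u k) t)"
proof (rule LIMSEQ_unique)
  show "(\<lambda>n. approx (Suc n) u (mark u k + weight u k * t)) \<longlonglongrightarrow> curve u (mark u k + weight u k * t)"
    by (rule LIMSEQ_Suc[OF approx_tendsto_curve[OF u cell_range[OF u k t]]])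
  have "isCont (S (idx u k)) (curve (edge u k) t)"
    using S_continuous[OF idx_range[OF u k]] by (simp add: continuous_on_eq_continuous_at)
  then show "(\<lambda>n. approx (Suc n) u (mark u k + weight u k * t)) \<longlonglongrightarrow> S (idx u k) (curve (edge u k) t)"
    unfolding approx_cell[OF u k t]
    by (rule isCont_tendsto_compose[OF _ approx_tendsto_curve[OF edge[OF u k] t]])
qed

section \<open>Hoelder continuity and surjectivity\<close>

lemma weight_root: "u \<in> V \<Longrightarrow> k < N \<Longrightarrow> weight u k powr (1 / s) = r (idx u k)"
  using ratio(1)[OF idx_range, of u k] s_pos by (simp add: weight_def powr_powr)

text \<open>
  A cell of length \<open>r\<^sup>s\<close> carries a copy scaled by \<open>r = (r\<^sup>s)\<^sup>1\<^sup>/\<^sup>s\<close>, so a Hoelder estimate with exponent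
  \<open>1 / s\<close> passes to the cell with the same constant.
\<close>

lemma cell_holder:
  assumes u: "u \<in> V" and k: "k < N" and xy: "x \<in> {0..1}" "y \<in> {0..1}"
    and le: "dist (curve (edge u k) x) (curve (edge u k) y) \<le> C * \<bar>x - y\<bar> powr (1 / s)"
    and p: "p = mark u k + weight u k * x" and q: "q = mark u k + weight u k * y"
  shows "dist (curve u p) (curve u q) \<le> C * \<bar>p - q\<bar> powr (1 / s)"
proof -
  note j = idx_range[OF u k]
  have w: "0 < weight u k" by (rule weight_bounds(1)[OF u k])
  have "dist (curve u p) (curve u q) = r (idx u k) * dist (curve (edge u k) x) (curve (edge u k) y)"
    unfolding p q curve_cell[OF u k xy(1)] curve_cell[OF u k xy(2)] by (rule similitude[OF j])
  also have "\<dots> \<le> r (idx u k) * (C * \<bar>x - y\<bar> powr (1 / s))"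
    using le ratio(1)[OF j] by (intro mult_left_mono) auto
  also have "\<dots> = C * (weight u k * \<bar>x - y\<bar>) powr (1 / s)"
    using w by (simp add: powr_mult weight_root[OF u k])
  also have "weight u k * \<bar>x - y\<bar> = \<bar>p - q\<bar>"
    using w unfolding p q by (simp add: abs_mult flip: right_diff_distrib)
  finally show ?thesis .
qed

text \<open>
  No cell is shorter than \<open>rmin\<^sup>s\<close>. Parameters at least that far apart satisfy a Hoelder estimate
  simply because \<open>K\<close> is bounded; this is where the rescaling of closer parameters ends.
\<close>

lemma dist_le_far:
  assumes D: "0 < D" "\<forall>x\<in>K. \<forall>y\<in>K. dist x y \<le> D"
    and u: "u \<in> V" and xy: "x \<in> {0..1}" "y \<in> {0..1}" and far: "rmin powr s \<le> \<bar>x - y\<bar>"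
  shows "dist (curve u x) (curve u y) \<le> D / rmin * \<bar>x - y\<bar> powr (1 / s)"
proof -
  have "rmin = (rmin powr s) powr (1 / s)" using rmin(1) s_pos by (simp add: powr_powr)
  also have "\<dots> \<le> \<bar>x - y\<bar> powr (1 / s)" using far s_pos by (intro powr_mono2) auto
  finally have "D / rmin * rmin \<le> D / rmin * \<bar>x - y\<bar> powr (1 / s)"
    using D(1) rmin(1) by (intro mult_left_mono) auto
  then show ?thesis using D(2) curve_in_K[OF u xy(1)] curve_in_K[OF u xy(2)] rmin(1) by force
qed

lemma scale_up:
  assumes "u \<in> V" "k < N" and x: "(rmax powr s) ^ Suc n \<le> weight u k * x"
  shows "(rmax powr s) ^ n \<le> x"
proof -
  note w = weight_bounds[OF assms(1,2)]
  have "0 < weight u k * x" using x rmax(1) by (smt (verit) zero_less_power powr_gt_zero)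
  then have "0 < x" using w(1) by (simp add: zero_less_mult_iff)
  then have "weight u k * x \<le> rmax powr s * x" using w(4) by (intro mult_right_mono) auto
  then have "rmax powr s * (rmax powr s) ^ n \<le> rmax powr s * x" using x by simp
  then show ?thesis using rmax(1) by simp
qed

lemma power_rmax_le:
  assumes "0 < x" obtains n where "(rmax powr s) ^ n \<le> x"
proof -
  have "rmax powr s < 1" using powr_less_mono2[of s rmax 1] rmax s_pos by simp
  then show thesis using real_arch_pow_inv[OF assms] that less_imp_le by blast
qed

text \<open>
  As long as \<open>t\<close> stays in the first cell, the pair \<open>0, t\<close> can be rescaled by \<open>cell_holder\<close>. Each
  rescaling enlarges \<open>t\<close> by a definite factor, so the case of \<open>dist_le_far\<close> is reached after finitely
  many steps; the induction is on a bound for their number.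
\<close>

lemma holder_from_origin:
  assumes D: "0 < D" "\<forall>x\<in>K. \<forall>y\<in>K. dist x y \<le> D"
  shows "u \<in> V \<Longrightarrow> t \<in> {0..1} \<Longrightarrow> (rmax powr s) ^ n \<le> t \<Longrightarrow>
    dist (curve u 0) (curve u t) \<le> D / rmin * \<bar>0 - t\<bar> powr (1 / s)"
proof (induction n arbitrary: u t)
  case 0
  have "rmin powr s \<le> 1" using powr_mono2[of s rmin 1] rmin s_pos by simp
  then show ?case using 0 by (intro dist_le_far[OF D]) auto
next
  case (Suc n)
  show ?case
  proof (cases "t \<le> weight u 0")
    case True
    define t' where "t' = t / weight u 0"
    have w: "0 < weight u 0" by (rule weight_bounds(1)[OF Suc.prems(1) N])
    have t': "t' \<in> {0..1}" "t = mark u 0 + weight u 0 * t'"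
      using True w Suc.prems(2) by (simp_all add: t'_def)
    then have eq: "t = weight u 0 * t'" by simp
    have n: "(rmax powr s) ^ n \<le> t'"
      by (rule scale_up[OF Suc.prems(1) N ord_le_eq_trans[OF Suc.prems(3) eq]])
    show ?thesis
      using Suc.IH[OF edge[OF Suc.prems(1) N] t'(1) n]
      by (intro cell_holder[OF Suc.prems(1) N _ t'(1) _ _ t'(2), of 0]) simp_all
  next
    case False
    then show ?thesis
      using weight_bounds(3)[OF Suc.prems(1) N] Suc.prems by (intro dist_le_far[OF D]) auto
  qed
qed

lemma holder_to_terminus:
  assumes D: "0 < D" "\<forall>x\<in>K. \<forall>y\<in>K. dist x y \<le> D"
  shows "u \<in> V \<Longrightarrow> t \<in> {0..1} \<Longrightarrow> (rmax powr s) ^ n \<le> 1 - t \<Longrightarrow>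
    dist (curve u t) (curve u 1) \<le> D / rmin * \<bar>t - 1\<bar> powr (1 / s)"
proof (induction n arbitrary: u t)
  case 0
  have "rmin powr s \<le> 1" using powr_mono2[of s rmin 1] rmin s_pos by simp
  then show ?case using 0 by (intro dist_le_far[OF D]) auto
next
  case (Suc n)
  let ?k = "N - 1"
  have k: "?k < N" using N by simp
  have w: "0 < weight u ?k" by (rule weight_bounds(1)[OF Suc.prems(1) k])
  have one: "1 = mark u ?k + weight u ?k * 1"
    using mark_N[OF Suc.prems(1)] mark_Suc[of u ?k] N by simp
  show ?case
  proof (cases "mark u ?k \<le> t")
    case True
    define t' where "t' = (t - mark u ?k) / weight u ?k"
    have t': "t' \<in> {0..1}" "t = mark u ?k + weight u ?k * t'"
      using cell_coordinate[OF Suc.prems(1) k True] one mark_Suc[of u ?k] Suc.prems(2)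
      by (simp_all add: t'_def)
    have diff: "1 - t = weight u ?k * (1 - t')" using one t'(2) by (simp add: algebra_simps)
    have n: "(rmax powr s) ^ n \<le> 1 - t'"
      using Suc.prems(3) unfolding diff by (rule scale_up[OF Suc.prems(1) k])
    show ?thesis
      using Suc.IH[OF edge[OF Suc.prems(1) k] t'(1) n]
      by (intro cell_holder[OF Suc.prems(1) k t'(1) _ _ t'(2) one]) simp_all
  next
    case False
    then show ?thesis
      using weight_bounds(3)[OF Suc.prems(1) k] Suc.prems one by (intro dist_le_far[OF D]) auto
  qed
qed

lemma holder_ends:
  assumes D: "0 < D" "\<forall>x\<in>K. \<forall>y\<in>K. dist x y \<le> D"
    and u: "u \<in> V" and t: "t \<in> {0..1}"
  shows "dist (curve u 0) (curve u t) \<le> D / rmin * \<bar>0 - t\<bar> powr (1 / s)"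
    and "dist (curve u t) (curve u 1) \<le> D / rmin * \<bar>t - 1\<bar> powr (1 / s)"
proof -
  show "dist (curve u 0) (curve u t) \<le> D / rmin * \<bar>0 - t\<bar> powr (1 / s)"
  proof (cases "t = 0")
    case False
    then obtain n where "(rmax powr s) ^ n \<le> t" using power_rmax_le[of t] t by auto
    then show ?thesis by (rule holder_from_origin[OF D u t])
  qed simp
  show "dist (curve u t) (curve u 1) \<le> D / rmin * \<bar>t - 1\<bar> powr (1 / s)"
  proof (cases "t = 1")
    case False
    then obtain n where "(rmax powr s) ^ n \<le> 1 - t" using power_rmax_le[of "1 - t"] t by auto
    then show ?thesis by (rule holder_to_terminus[OF D u t])
  qed simp
qed

text \<open>
  Two parameters are rescaled until a mark separates them. The distance from the first parameter to the
  end \<open>m\<close> of its cell is controlled by the estimate at a terminus. If the second parameter lies in the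
  next cell, its distance from \<open>m\<close> is controlled by the estimate at an origin; otherwise it is far
  from \<open>m\<close>. The sum of the two estimates doubles the constant.
\<close>

lemma holder_pair:
  assumes D: "0 < D" "\<forall>x\<in>K. \<forall>y\<in>K. dist x y \<le> D"
  shows "u \<in> V \<Longrightarrow> x \<in> {0..1} \<Longrightarrow> y \<in> {0..1} \<Longrightarrow> x \<le> y \<Longrightarrow> (rmax powr s) ^ n \<le> y - x \<Longrightarrow>
    dist (curve u x) (curve u y) \<le> 2 * (D / rmin) * \<bar>x - y\<bar> powr (1 / s)"
proof (induction n arbitrary: u x y)
  case 0
  have "rmin powr s \<le> 1" using powr_mono2[of s rmin 1] rmin s_pos by simp
  then have "dist (curve u x) (curve u y) \<le> D / rmin * \<bar>x - y\<bar> powr (1 / s)"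
    using 0 by (intro dist_le_far[OF D]) auto
  moreover have "0 \<le> D / rmin * \<bar>x - y\<bar> powr (1 / s)"
    using D(1) rmin(1) by simp
  ultimately show ?case by linarith
next
  case (Suc n)
  note u = Suc.prems(1)
  obtain i x' where i: "i < N" "x' \<in> {0..1}" "x = mark u i + weight u i * x'"
    using cell_cases[OF u Suc.prems(2)] by blast
  obtain k y' where k: "k < N" "y' \<in> {0..1}" "y = mark u k + weight u k * y'"
    using cell_cases[OF u Suc.prems(3)] by blast
  have wi: "0 < weight u i" and wk: "0 < weight u k" using weight_bounds(1)[OF u] i k by auto
  have x_le: "mark u i \<le> x" "x \<le> mark u (Suc i)" and y_le: "mark u k \<le> y" "y \<le> mark u (Suc k)"
    using wi wk i k by (auto simp: mark_Suc)
  show ?case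
  proof (cases "i = k")
    case True
    have diff: "y - x = weight u i * (y' - x')" using i(3) k(3) True by (simp add: algebra_simps)
    have n: "(rmax powr s) ^ n \<le> y' - x'"
      using Suc.prems(5) unfolding diff by (rule scale_up[OF u i(1)])
    then have "x' \<le> y'" using rmax(1) by (smt (verit) zero_less_power powr_gt_zero)
    then show ?thesis
      using Suc.IH[OF edge[OF u i(1)] i(2) k(2) _ n] i k True
      by (intro cell_holder[OF u i(1) i(2) k(2)]) auto
  next
    case False
    have "i < k"
    proof (rule ccontr)
      assume "\<not> i < k"
      then have "Suc k \<le> i" using False by simp
      then have "mark u (Suc k) \<le> mark u i" using mark_le[OF u] i by simp
      then have "x = y" using x_le y_le Suc.prems(4) by linarith
      moreover have "0 < (rmax powr s) ^ Suc n" using rmax(1) by (intro zero_less_power) simp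
      ultimately show False using Suc.prems(5) by linarith
    qed
    define m where "m = mark u (Suc i)"
    have m: "x \<le> m" "m \<le> y" "m \<in> {0..1}"
      using x_le y_le mark_le[OF u, of "Suc i" k] mark_range[OF u, of "Suc i"] \<open>i < k\<close> k i by (auto simp: m_def)
    have first: "dist (curve u x) (curve u m) \<le> D / rmin * \<bar>x - m\<bar> powr (1 / s)"
      using holder_ends(2)[OF D edge[OF u i(1)] i(2)] i
      by (intro cell_holder[OF u i(1) i(2), of 1]) (auto simp: m_def mark_Suc)
    have second: "dist (curve u m) (curve u y) \<le> D / rmin * \<bar>m - y\<bar> powr (1 / s)"
    proof (cases "k = Suc i")
      case True
      then show ?thesis
        using holder_ends(1)[OF D edge[OF u k(1)] k(2)] k
        by (intro cell_holder[OF u k(1) _ k(2), of 0]) (auto simp: m_def)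
    next
      case False
      then have "mark u (Suc (Suc i)) \<le> y"
        using mark_le[OF u, of "Suc (Suc i)" k] \<open>i < k\<close> k y_le by simp
      then have "rmin powr s \<le> \<bar>m - y\<bar>"
        using weight_bounds(3)[OF u, of "Suc i"] \<open>i < k\<close> k by (simp add: m_def mark_Suc)
      then show ?thesis by (intro dist_le_far[OF D u m(3) Suc.prems(3)])
    qed
    have mono: "\<bar>x - m\<bar> powr (1 / s) \<le> \<bar>x - y\<bar> powr (1 / s)" "\<bar>m - y\<bar> powr (1 / s) \<le> \<bar>x - y\<bar> powr (1 / s)"
      using m s_pos by (auto intro!: powr_mono2)
    have "dist (curve u x) (curve u y) \<le> dist (curve u x) (curve u m) + dist (curve u m) (curve u y)"
      by (rule dist_triangle)
    also have "\<dots> \<le> D / rmin * \<bar>x - y\<bar> powr (1 / s) + D / rmin * \<bar>x - y\<bar> powr (1 / s)"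
      using D(1) rmin(1)
      by (intro add_mono order_trans[OF first] order_trans[OF second] mult_left_mono mono) auto
    finally show ?thesis by (simp add: algebra_simps)
  qed
qed

lemma curve_holder:
  "\<exists>C>0. \<forall>u\<in>V. \<forall>x\<in>{0..1}. \<forall>y\<in>{0..1}.
    dist (curve u x) (curve u y) \<le> C * \<bar>x - y\<bar> powr (1 / s)"
proof -
  obtain D where D: "0 < D" "\<forall>x\<in>K. \<forall>y\<in>K. dist x y \<le> D" using K_dist_bound by blast
  have le: "dist (curve u x) (curve u y) \<le> 2 * (D / rmin) * \<bar>x - y\<bar> powr (1 / s)"
    if "u \<in> V" "x \<in> {0..1}" "y \<in> {0..1}" "x \<le> y" for u x y
  proof (cases "x = y")
    case False
    then have "0 < y - x" using that(4) by simp
    then obtain n where "(rmax powr s) ^ n \<le> y - x" by (rule power_rmax_le)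
    then show ?thesis by (rule holder_pair[OF D that])
  qed simp
  show ?thesis
  proof (intro exI[of _ "2 * (D / rmin)"] conjI ballI)
    show "0 < 2 * (D / rmin)" using D(1) rmin(1) by simp
    fix u x y :: _ assume u: "u \<in> V" and xy: "x \<in> {0..1::real}" "y \<in> {0..1::real}"
    show "dist (curve u x) (curve u y) \<le> 2 * (D / rmin) * \<bar>x - y\<bar> powr (1 / s)"
    proof (cases "x \<le> y")
      case True
      then show ?thesis by (rule le[OF u xy])
    next
      case False
      then have "dist (curve u y) (curve u x) \<le> 2 * (D / rmin) * \<bar>y - x\<bar> powr (1 / s)"
        by (intro le[OF u xy(2,1)]) simp
      then show ?thesis unfolding dist_commute[of "curve u y"] abs_minus_commute[of y] .
    qed
  qed
qed

lemma curve_continuous: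
  assumes u: "u \<in> V" shows "continuous_on {0..1} (curve u)"
proof -
  obtain C where C: "0 < C \<and> (\<forall>u\<in>V. \<forall>x\<in>{0..1}. \<forall>y\<in>{0..1}.
      dist (curve u x) (curve u y) \<le> C * \<bar>x - y\<bar> powr (1 / s))"
    using curve_holder ..
  have "0 < 1 / s" using s_pos by simp
  moreover have "dist (curve u x) (curve u y) \<le> C * \<bar>x - y\<bar> powr (1 / s)"
    if "x \<in> {0..1}" "y \<in> {0..1}" for x y
    using bspec[OF bspec[OF bspec[OF conjunct2[OF C] u] that(1)] that(2)] .
  ultimately show ?thesis by (rule holder_imp_continuous_on)
qed

lemma curve_near:
  assumes D: "\<forall>x\<in>K. \<forall>y\<in>K. dist x y \<le> D"
  shows "u \<in> V \<Longrightarrow> p \<in> K \<Longrightarrow> \<exists>t\<in>{0..1}. dist p (curve u t) \<le> D * rmax ^ n"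
proof (induction n arbitrary: u p)
  case 0
  have "dist p (curve u 0) \<le> D" using D 0(2) curve_in_K[OF 0(1), of 0] by simp
  then show ?case by (intro bexI[of _ 0]) simp_all
next
  case (Suc n)
  obtain j q where q: "j \<in> {1..N}" "q \<in> K" "p = S j q" 
    using subsetD[OF equalityD1[OF K_eq] Suc.prems(2)] by blast
  have "j \<in> idx u ` {..<N}" using bij_betw_imp_surj_on[OF idx[OF Suc.prems(1)]] q(1) by simp
  then obtain k where k: "k < N" "idx u k = j" by auto
  obtain t where t: "t \<in> {0..1}" "dist q (curve (edge u k) t) \<le> D * rmax ^ n"
    using Suc.IH[OF edge[OF Suc.prems(1) k(1)] q(2)] by blast
  have "dist p (curve u (mark u k + weight u k * t)) = r j * dist q (curve (edge u k) t)"
    unfolding curve_cell[OF Suc.prems(1) k(1) t(1)] q(3) k(2) by (rule similitude[OF q(1)])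
  also have "\<dots> \<le> rmax * (D * rmax ^ n)"
    using t(2) rmax(1) rmax(3)[OF q(1)] by (intro mult_mono) auto
  finally have "dist p (curve u (mark u k + weight u k * t)) \<le> D * rmax ^ Suc n" by (simp add: mult_ac)
  then show ?case using cell_range[OF Suc.prems(1) k(1) t(1)] by blast
qed

text \<open>
  The image of each curve is dense in \<open>K\<close>, because every point of \<open>K\<close> lies in cells of arbitrarily
  high level; and it is compact.
\<close>

lemma curve_onto:
  assumes u: "u \<in> V" shows "curve u ` {0..1} = K"
proof
  show "curve u ` {0..1} \<subseteq> K" using curve_in_K[OF u] by blast
  show "K \<subseteq> curve u ` {0..1}"
  proof
    fix p assume p: "p \<in> K"
    obtain D where D: "0 < D" "\<forall>x\<in>K. \<forall>y\<in>K. dist x y \<le> D" using K_dist_bound by blast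
    have "(\<lambda>n. D * rmax ^ n) \<longlonglongrightarrow> 0"
      using rmax by (intro tendsto_mult_right_zero LIMSEQ_power_zero) auto
    moreover have "infdist p (curve u ` {0..1}) \<le> D * rmax ^ n" for n
    proof -
      obtain t where t: "t \<in> {0..1}" "dist p (curve u t) \<le> D * rmax ^ n"
        using curve_near[OF D(2) u p, of n] by blast
      show ?thesis using t by (intro infdist_le2[of "curve u t"] imageI)
    qed
    ultimately have "infdist p (curve u ` {0..1}) \<le> 0" by (intro LIMSEQ_le_const) auto
    then have "infdist p (curve u ` {0..1}) = 0" using infdist_nonneg by (rule antisym)
    moreover have "closed (curve u ` {0..1})"
      using curve_continuous[OF u] by (intro compact_imp_closed compact_continuous_image) auto
    ultimately show "p \<in> curve u ` {0..1}" 
      using in_closed_iff_infdist_zero[of "curve u ` {0..1}" p] by simp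
  qed
qed

section \<open>Occupation times under the open set condition\<close>

definition occupation :: "'b \<Rightarrow> 'a set \<Rightarrow> ennreal" where
  "occupation u B = emeasure lebesgue {t \<in> {0..1}. curve u t \<in> B}"

lemma occupation_set: "u \<in> V \<Longrightarrow> B \<in> sets borel \<Longrightarrow> {t \<in> {0..1}. curve u t \<in> B} \<in> sets lebesgue"
  using continuous_on_preimage_borel[OF curve_continuous] by simp

lemma occupation_mono:
  assumes "u \<in> V" "C \<in> sets borel" "B \<subseteq> C" shows "occupation u B \<le> occupation u C"
  unfolding occupation_def using assms(3) by (intro emeasure_mono occupation_set assms(1,2)) blast

lemma occupation_le_1: "occupation u B \<le> 1"
proof -
  have "occupation u B \<le> emeasure lebesgue {0..1::real}"
    unfolding occupation_def by (intro emeasure_mono) auto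
  then show ?thesis by simp
qed

lemma occupation_le_sum:
  assumes u: "u \<in> V" and B: "B \<in> sets borel"
  shows "occupation u B \<le> (\<Sum>k<N. ennreal (weight u k) * occupation (edge u k) {y. S (idx u k) y \<in> B})"
proof -
  let ?T = "{t \<in> {0..1}. curve u t \<in> B}"
  let ?A = "\<lambda>k. ?T \<inter> {mark u k..mark u (Suc k)}"
  have T: "?T \<in> sets lebesgue" by (rule occupation_set[OF u B])
  have "?T \<subseteq> (\<Union>k<N. ?A k)"
  proof
    fix t assume t: "t \<in> ?T"
    then have t01: "t \<in> {0..1}" by simp
    have "t \<in> ?A (cell u t)" using t cell(2,3)[OF u t01] by simp
    then show "t \<in> (\<Union>k<N. ?A k)" using cell(1)[OF u t01] by blast
  qed
  then have "occupation u B \<le> emeasure lebesgue (\<Union>k<N. ?A k)"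
    unfolding occupation_def using T by (intro emeasure_mono) auto
  also have "\<dots> \<le> (\<Sum>k<N. emeasure lebesgue (?A k))"
    using T by (intro emeasure_subadditive_finite) auto
  also have "\<dots> \<le> (\<Sum>k<N. ennreal (weight u k) * occupation (edge u k) {y. S (idx u k) y \<in> B})"
  proof (rule sum_mono)
    fix k assume "k \<in> {..<N}"
    then have k: "k < N" by simp
    have w: "0 < weight u k" by (rule weight_bounds(1)[OF u k])
    let ?P = "{t \<in> {0..1}. curve (edge u k) t \<in> {y. S (idx u k) y \<in> B}}"
    have "?A k = (\<lambda>t. weight u k *\<^sub>R t + mark u k) ` ?P"
    proof (intro equalityI subsetI)
      fix t assume t: "t \<in> ?A k"
      define t' where "t' = (t - mark u k) / weight u k"
      have t': "t' \<in> {0..1}" "t = mark u k + weight u k * t'"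
        unfolding t'_def using t by (intro cell_coordinate[OF u k]; simp)+
      have "curve u t \<in> B" using t by simp
      then have "t' \<in> ?P" using curve_cell[OF u k t'(1)] t'(1) by (simp flip: t'(2))
      then show "t \<in> (\<lambda>t. weight u k *\<^sub>R t + mark u k) ` ?P"
        using t'(2) by (intro image_eqI[of _ _ t']) simp_all
    next
      fix t assume "t \<in> (\<lambda>t. weight u k *\<^sub>R t + mark u k) ` ?P"
      then obtain t' where t': "t' \<in> ?P" "t = mark u k + weight u k * t'" by (auto simp: add.commute)
      then have "t' \<in> {0..1}" by simp
      moreover from this have "weight u k * t' \<le> weight u k * 1" using w by (intro mult_left_mono) auto
      ultimately show "t \<in> ?A k"
        using t' w curve_cell[OF u k, of t'] cell_range[OF u k, of t'] by (simp add: mark_Suc)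
    qed
    then show "emeasure lebesgue (?A k) \<le> ennreal (weight u k) * occupation (edge u k) {y. S (idx u k) y \<in> B}"
      using emeasure_lebesgue_affine[of "weight u k" "mark u k" ?P] w by (simp add: occupation_def)
  qed
  finally show ?thesis .
qed

lemma S_surj:
  assumes j: "j \<in> {1..N}" obtains y where "S j y = x"
proof -
  have r: "0 < r j" by (rule ratio(1)[OF j])
  have "x \<in> ball (S j 0) (r j * ((dist (S j 0) x + 1) / r j))" using r by simp
  then show thesis
    using similitude_image_ball[OF r similitude[OF j], of 0 "(dist (S j 0) x + 1) / r j"] that by force
qed

lemma similitude_parts_volume_le:
  assumes G: "open G" "\<And>j. j \<in> {1..N} \<Longrightarrow> S j ` G \<subseteq> G" "disjoint_family_on (\<lambda>j. S j ` G) {1..N}"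
    and u: "u \<in> V" and y: "\<And>k. k < N \<Longrightarrow> S (idx u k) (y k) = x"
  shows "(\<Sum>k<N. ennreal (r (idx u k) ^ DIM('a)) * emeasure lborel (G \<inter> ball (y k) (R / r (idx u k))))
    \<le> emeasure lborel (G \<inter> ball x R)"
proof -
  let ?P = "\<lambda>k. G \<inter> ball (y k) (R / r (idx u k))" and ?S = "\<lambda>k. S (idx u k)"
  note j = idx_range[OF u]
  have open_P: "open (?S k ` ?P k)" if "k < N" for k
    by (rule similitude_image_open[OF ratio(1)[OF j[OF that]] similitude[OF j[OF that]]])
      (intro open_Int G(1) open_ball)
  have P_ball: "?S k ` ?P k \<subseteq> ball x R" if "k < N" for k
    using similitude_image_ball[OF ratio(1)[OF j[OF that]] similitude[OF j[OF that]], of "y k" "R / r (idx u k)"]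
      y[OF that] ratio(1)[OF j[OF that]] by auto
  have inj: "inj_on (idx u) {..<N}" using idx[OF u] by (rule bij_betw_imp_inj_on)
  have disj: "disjoint_family_on (\<lambda>k. ?S k ` ?P k) {..<N}"
    unfolding disjoint_family_on_def
  proof (intro ballI impI)
    fix i k assume ik: "i \<in> {..<N}" "k \<in> {..<N}" "i \<noteq> k"
    then have "idx u i \<noteq> idx u k" using inj by (auto dest: inj_onD)
    then have "?S i ` G \<inter> ?S k ` G = {}"
      using G(3) j[of i] j[of k] ik unfolding disjoint_family_on_def by blast
    then show "?S i ` ?P i \<inter> ?S k ` ?P k = {}" by blast
  qed
  have "(\<Sum>k<N. ennreal (r (idx u k) ^ DIM('a)) * emeasure lborel (?P k))
      \<le> (\<Sum>k<N. emeasure lborel (?S k ` ?P k))"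
  proof (rule sum_mono)
    fix k assume "k \<in> {..<N}"
    then have "k < N" by simp
    show "ennreal (r (idx u k) ^ DIM('a)) * emeasure lborel (?P k) \<le> emeasure lborel (?S k ` ?P k)"
      by (rule similitude_volume_ge[OF ratio(1)[OF j[OF \<open>k < N\<close>]] similitude[OF j[OF \<open>k < N\<close>]]])
        (intro open_Int G(1) open_ball)
  qed
  also have "\<dots> = emeasure lborel (\<Union>k<N. ?S k ` ?P k)"
    using open_P disj by (intro sum_emeasure) auto
  also have "\<dots> \<le> emeasure lborel (G \<inter> ball x R)"
  proof (rule emeasure_mono)
    have "?S k ` ?P k \<subseteq> G" if "k < N" for k using G(2)[OF j[OF that]] by blast
    then show "(\<Union>k<N. ?S k ` ?P k) \<subseteq> G \<inter> ball x R" using P_ball by blast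
    show "G \<inter> ball x R \<in> sets lborel" using G(1) by simp
  qed
  finally show ?thesis .
qed

text \<open>
  If the ball has radius at least \<open>1\<close> and meets the curve, then the enlarged ball contains the fixed ball around
  \<open>x0\<close>, and \<open>\<kappa>\<close> is chosen to make the inequality true. For smaller radii both sides are compared cell by
  cell with those for the rescaled balls of radius \<open>\<delta> / r\<^sub>j\<close>: the factor \<open>r\<^sub>j\<^sup>s\<close> from the length of the cell
  and the factor \<open>r\<^sub>j\<^sup>d\<^sup>-\<^sup>s\<close> from the power of \<open>\<delta>\<close> combine to \<open>r\<^sub>j\<^sup>d\<close>, which is what the volumes of the
  disjoint parts of \<open>G\<close> require. The bound \<open>\<delta> \<le> 1 / rmin\<close> holds whenever a radius below \<open>1\<close> has
  been rescaled once.
\<close>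

lemma occupation_le_volume:
  assumes G: "open G" "\<And>j. j \<in> {1..N} \<Longrightarrow> S j ` G \<subseteq> G" "disjoint_family_on (\<lambda>j. S j ` G) {1..N}"
    and x0: "0 < \<rho>" "ball x0 \<rho> \<subseteq> G" and D: "0 \<le> D" "\<forall>p\<in>K. dist x0 p \<le> D"
    and L: "L = 1 + D + \<rho>" and \<kappa>: "\<kappa> = unit_ball_vol (DIM('a)) * \<rho> ^ DIM('a) * rmin ^ DIM('a)"
  shows "u \<in> V \<Longrightarrow> rmax ^ n \<le> \<delta> \<Longrightarrow> \<delta> \<le> 1 / rmin \<Longrightarrow>
    ennreal \<kappa> * occupation u (ball x \<delta>)
      \<le> ennreal (\<delta> powr (s - DIM('a))) * emeasure lborel (G \<inter> ball x (L * \<delta>))"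
proof (induction n arbitrary: u x \<delta>)
  have base: "ennreal \<kappa> * occupation u (ball x \<delta>)
      \<le> ennreal (\<delta> powr (s - DIM('a))) * emeasure lborel (G \<inter> ball x (L * \<delta>))"
    if u: "u \<in> V" and \<delta>: "1 \<le> \<delta>" "\<delta> \<le> 1 / rmin" for u x \<delta>
  proof (cases "\<exists>t\<in>{0..1}. curve u t \<in> ball x \<delta>")
    case False
    then have empty: "{t \<in> {0..1}. curve u t \<in> ball x \<delta>} = {}" by blast
    have "occupation u (ball x \<delta>) = 0" unfolding occupation_def empty by simp
    then show ?thesis by simp
  next
    case True
    then obtain t where t: "t \<in> {0..1}" "curve u t \<in> ball x \<delta>" by blast
    define p where "p = curve u t"
    have p: "p \<in> K" "dist x p < \<delta>" using t curve_in_K[OF u] by (simp_all add: p_def)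
    have ball: "ball x0 \<rho> \<subseteq> G \<inter> ball x (L * \<delta>)"
    proof (intro Int_greatest x0(2) subsetI)
      fix z assume z: "z \<in> ball x0 \<rho>"
      have "dist x0 z < \<rho>" "dist x0 p \<le> D" using z p(1) D(2) by simp_all
      then have "dist x z < \<delta> + D + \<rho>"
        using dist_triangle[of x z x0] dist_triangle2[of x x0 p] p(2) by (simp add: dist_commute)
      also have "\<dots> \<le> L * \<delta>"
      proof -
        have "D + \<rho> \<le> (D + \<rho>) * \<delta>" using D(1) x0(1) \<delta>(1) mult_left_mono[of 1 \<delta> "D + \<rho>"] by simp
        then show ?thesis by (simp add: L distrib_right)
      qed
      finally show "z \<in> ball x (L * \<delta>)" by simp
    qed
    have "rmin ^ DIM('a) \<le> \<delta> powr (s - DIM('a))"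
    proof -
      have "rmin ^ DIM('a) = (1 / rmin) powr (- DIM('a))"
        using rmin(1) by (simp add: powr_minus_divide powr_divide powr_realpow)
      also have "\<dots> \<le> \<delta> powr (- DIM('a))" using \<delta> by (intro powr_mono2') auto
      also have "\<dots> \<le> \<delta> powr (s - DIM('a))" using \<delta>(1) s_pos by (intro powr_mono) auto
      finally show ?thesis .
    qed
    then have "unit_ball_vol (DIM('a)) * \<rho> ^ DIM('a) * rmin ^ DIM('a)
        \<le> unit_ball_vol (DIM('a)) * \<rho> ^ DIM('a) * \<delta> powr (s - DIM('a))"
      using x0(1) by (intro mult_left_mono) auto
    then have "\<kappa> \<le> \<delta> powr (s - DIM('a)) * (unit_ball_vol (DIM('a)) * \<rho> ^ DIM('a))"
      by (simp add: \<kappa> mult_ac)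
    then have "ennreal \<kappa> \<le> ennreal (\<delta> powr (s - DIM('a))) * emeasure lborel (ball x0 \<rho>)"
      using x0(1) by (simp add: emeasure_ball ennreal_leI flip: ennreal_mult)
    also have "\<dots> \<le> ennreal (\<delta> powr (s - DIM('a))) * emeasure lborel (G \<inter> ball x (L * \<delta>))"
      using ball G(1) by (intro mult_left_mono emeasure_mono) auto
    finally have le: "ennreal \<kappa> \<le> ennreal (\<delta> powr (s - DIM('a))) * emeasure lborel (G \<inter> ball x (L * \<delta>))" .
    have "ennreal \<kappa> * occupation u (ball x \<delta>) \<le> ennreal \<kappa> * 1"
      by (intro mult_left_mono occupation_le_1) simp
    also have "\<dots> = ennreal \<kappa>" by simp
    finally show ?thesis using le by (rule order_trans)
  qed
  {
    case 0
    then show ?case by (intro base) simp_all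
  next
    case (Suc n)
    note u = Suc.prems(1)
    show ?case
    proof (cases "1 \<le> \<delta>")
      case True
      then show ?thesis using Suc.prems by (intro base)
    next
      case False
      have \<delta>0: "0 < \<delta>" using Suc.prems(2) rmax(1) zero_less_power[of rmax "Suc n"] by linarith
      note j = idx_range[OF u]
      have "\<forall>k\<in>{..<N}. \<exists>y. S (idx u k) y = x"
      proof
        fix k assume "k \<in> {..<N}"
        then have k: "k < N" by simp
        obtain y where "S (idx u k) y = x" by (rule S_surj[OF j[OF k]])
        then show "\<exists>y. S (idx u k) y = x" ..
      qed
      then have "\<exists>y. \<forall>k\<in>{..<N}. S (idx u k) (y k) = x" by (rule bchoice)
      then obtain y where "\<forall>k\<in>{..<N}. S (idx u k) (y k) = x" ..
      then have y: "S (idx u k) (y k) = x" if "k < N" for k using that by simp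
      let ?r = "\<lambda>k. r (idx u k)"
      have preimage: "{z. S (idx u k) z \<in> ball x \<delta>} = ball (y k) (\<delta> / ?r k)" if k: "k < N" for k
      proof -
        have "dist x (S (idx u k) z) = ?r k * dist (y k) z" for z
          using similitude[OF j[OF k], of "y k" z] y[OF k] by simp
        then show ?thesis using ratio(1)[OF j[OF k]] by (auto simp: less_divide_eq mult.commute)
      qed
      have IH: "ennreal \<kappa> * occupation (edge u k) (ball (y k) (\<delta> / ?r k))
          \<le> ennreal ((\<delta> / ?r k) powr (s - DIM('a))) * emeasure lborel (G \<inter> ball (y k) (L * (\<delta> / ?r k)))"
        if k: "k < N" for k
      proof (rule Suc.IH[OF edge[OF u k]])
        have "rmax ^ n * ?r k \<le> rmax ^ n * rmax" using rmax(1) rmax(3)[OF j[OF k]] by (intro mult_left_mono) auto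
        then have "rmax ^ n * ?r k \<le> \<delta>" using Suc.prems(2) by (simp add: mult.commute)
        then show "rmax ^ n \<le> \<delta> / ?r k" using ratio(1)[OF j[OF k]] by (simp add: le_divide_eq)
        show "\<delta> / ?r k \<le> 1 / rmin"
          using False \<delta>0 rmin(1) rmin(3)[OF j[OF k]] by (intro frac_le) auto
      qed
      have scale: "weight u k * (\<delta> / ?r k) powr (s - DIM('a)) = \<delta> powr (s - DIM('a)) * ?r k ^ DIM('a)"
        if k: "k < N" for k
      proof -
        have r0: "0 < ?r k" by (rule ratio(1)[OF j[OF k]])
        have "weight u k = ?r k powr (s - DIM('a)) * ?r k ^ DIM('a)"
          using r0 by (simp add: weight_def powr_diff powr_realpow)
        then show ?thesis using r0 by (simp add: powr_divide)
      qed
      have "ennreal \<kappa> * occupation u (ball x \<delta>)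
          \<le> ennreal \<kappa> * (\<Sum>k<N. ennreal (weight u k) * occupation (edge u k) {z. S (idx u k) z \<in> ball x \<delta>})"
        by (intro mult_left_mono occupation_le_sum[OF u]) simp_all
      also have "\<dots> = (\<Sum>k<N. ennreal (weight u k) * (ennreal \<kappa> * occupation (edge u k) (ball (y k) (\<delta> / ?r k))))"
        unfolding sum_distrib_left by (intro sum.cong) (simp_all only: preimage lessThan_iff mult.left_commute)
      also have "\<dots> \<le> (\<Sum>k<N. ennreal (weight u k) * (ennreal ((\<delta> / ?r k) powr (s - DIM('a)))
          * emeasure lborel (G \<inter> ball (y k) (L * (\<delta> / ?r k)))))"
        by (intro sum_mono mult_left_mono IH) simp_all
      also have "\<dots> = ennreal (\<delta> powr (s - DIM('a))) *
          (\<Sum>k<N. ennreal (?r k ^ DIM('a)) * emeasure lborel (G \<inter> ball (y k) (L * \<delta> / ?r k)))"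
        unfolding sum_distrib_left
      proof (rule sum.cong[OF refl])
        fix k assume "k \<in> {..<N}"
        then have k: "k < N" by simp
        have "ennreal (weight u k) * ennreal ((\<delta> / ?r k) powr (s - DIM('a)))
            = ennreal (\<delta> powr (s - DIM('a))) * ennreal (?r k ^ DIM('a))"
          using scale[OF k] weight_bounds(1)[OF u k] by (simp flip: ennreal_mult')
        then show "ennreal (weight u k) * (ennreal ((\<delta> / ?r k) powr (s - DIM('a)))
            * emeasure lborel (G \<inter> ball (y k) (L * (\<delta> / ?r k))))
          = ennreal (\<delta> powr (s - DIM('a))) *
            (ennreal (?r k ^ DIM('a)) * emeasure lborel (G \<inter> ball (y k) (L * \<delta> / ?r k)))"
          by (simp only: mult.assoc[symmetric] times_divide_eq_right)
      qed
      also have "\<dots> \<le> ennreal (\<delta> powr (s - DIM('a))) * emeasure lborel (G \<inter> ball x (L * \<delta>))"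
        by (intro mult_left_mono similitude_parts_volume_le[OF G u y]) simp_all
      finally show ?thesis .
    qed
  }
qed

section \<open>Measure and dimension of the invariant set\<close>

lemma occupation_ball_le:
  assumes osc: "open_set_condition N S"
  shows "\<exists>C>0. \<forall>u\<in>V. \<forall>x. \<forall>\<delta>. 0 < \<delta> \<and> \<delta> \<le> 1 \<longrightarrow> occupation u (ball x \<delta>) \<le> ennreal (C * \<delta> powr s)"
proof -
  obtain G where G: "open G" "G \<noteq> {}" "(\<Union>j\<in>{1..N}. S j ` G) \<subseteq> G" "disjoint_family_on (\<lambda>j. S j ` G) {1..N}"
    using osc unfolding open_set_condition_def by blast
  then have G_sub: "S j ` G \<subseteq> G" if "j \<in> {1..N}" for j using that by blast
  obtain x0 where "x0 \<in> G" using G(2) by blast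
  then obtain \<rho> where \<rho>: "0 < \<rho>" "ball x0 \<rho> \<subseteq> G" using G(1) open_contains_ball by blast
  obtain D where D: "\<forall>p\<in>K. dist x0 p \<le> D"
    using compact_imp_bounded[OF compact_K] bounded_any_center[of K x0] by blast
  have D0: "0 \<le> D"
  proof -
    obtain p where "p \<in> K" using K_nonempty by blast
    then show ?thesis using D zero_le_dist[of x0 p] order_trans by blast
  qed
  define L where "L = 1 + D + \<rho>"
  define \<omega> where "\<omega> = unit_ball_vol (DIM('a))"
  define \<kappa> where "\<kappa> = unit_ball_vol (DIM('a)) * \<rho> ^ DIM('a) * rmin ^ DIM('a)"
  have \<omega>: "0 < \<omega>" by (simp add: \<omega>_def)
  have \<kappa>: "0 < \<kappa>" using \<rho>(1) rmin(1) by (simp add: \<kappa>_def)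
  have L: "0 < L" using D0 \<rho>(1) by (simp add: L_def)
  show ?thesis
  proof (intro exI[of _ "\<omega> * L ^ DIM('a) / \<kappa>"] conjI ballI allI impI)
    show "0 < \<omega> * L ^ DIM('a) / \<kappa>" using \<omega> \<kappa> L by simp
    fix u x and \<delta> :: real assume u: "u \<in> V" and \<delta>: "0 < \<delta> \<and> \<delta> \<le> 1"
    obtain n where n: "rmax ^ n \<le> \<delta>"
      using real_arch_pow_inv[of \<delta> rmax] \<delta> rmax(2) less_imp_le by blast
    have "\<delta> \<le> 1 / rmin" using \<delta> rmin(1,2) by (simp add: le_divide_eq mult_le_one)
    then have "ennreal \<kappa> * occupation u (ball x \<delta>)
        \<le> ennreal (\<delta> powr (s - DIM('a))) * emeasure lborel (G \<inter> ball x (L * \<delta>))"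
      by (intro occupation_le_volume[OF G(1) _ G(4) \<rho> D0 D L_def \<kappa>_def u n] G_sub)
    also have "\<dots> \<le> ennreal (\<delta> powr (s - DIM('a))) * emeasure lborel (ball x (L * \<delta>))"
      by (intro mult_left_mono emeasure_mono) simp_all
    also have "\<dots> = ennreal (\<delta> powr (s - DIM('a)) * (\<omega> * (L * \<delta>) ^ DIM('a)))"
      using L \<delta> by (simp add: emeasure_ball \<omega>_def ennreal_mult')
    also have "\<delta> powr (s - DIM('a)) * (\<omega> * (L * \<delta>) ^ DIM('a)) = \<omega> * L ^ DIM('a) * \<delta> powr s"
      using \<delta> by (simp add: power_mult_distrib powr_diff powr_realpow)
    finally have le: "ennreal \<kappa> * occupation u (ball x \<delta>) \<le> ennreal (\<omega> * L ^ DIM('a) * \<delta> powr s)" .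
    have "occupation u (ball x \<delta>) < top" using occupation_le_1 by (rule order_le_less_trans) simp
    then obtain q where q: "occupation u (ball x \<delta>) = ennreal q" "0 \<le> q"
      by (cases "occupation u (ball x \<delta>)") auto
    have "0 \<le> \<omega> * L ^ DIM('a) * \<delta> powr s" using \<omega> L by simp
    then have "\<kappa> * q \<le> \<omega> * L ^ DIM('a) * \<delta> powr s"
      using le q \<kappa> by (simp flip: ennreal_mult)
    then have "q \<le> \<omega> * L ^ DIM('a) / \<kappa> * \<delta> powr s" using \<kappa> by (simp add: le_divide_eq mult.commute)
    then show "occupation u (ball x \<delta>) \<le> ennreal (\<omega> * L ^ DIM('a) / \<kappa> * \<delta> powr s)"
      unfolding q(1) by (rule ennreal_leI)
  qed
qed

text \<open>
  A closed ball of radius \<open>d > 0\<close> lies in the open ball of radius \<open>2 d\<close>; the case \<open>d = 0\<close>, which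
  occurs for covers by single points, needs a limit.
\<close>

lemma occupation_cball_le:
  assumes C: "0 < C" "\<forall>x. \<forall>\<delta>. 0 < \<delta> \<and> \<delta> \<le> 1 \<longrightarrow> occupation u (ball x \<delta>) \<le> ennreal (C * \<delta> powr s)"
    and u: "u \<in> V" and d: "0 \<le> d" "d \<le> 1 / 2"
  shows "occupation u (cball x d) \<le> ennreal (C * 2 powr s * d powr s)"
proof (cases "d = 0")
  case False
  have "cball x d \<subseteq> ball x (2 * d)" using False d(1) by (auto simp: subset_iff)
  then have "occupation u (cball x d) \<le> occupation u (ball x (2 * d))"
    by (intro occupation_mono[OF u]) simp_all
  also have "\<dots> \<le> ennreal (C * (2 * d) powr s)" using C(2) False d by simp
  finally show ?thesis using d(1) by (simp add: powr_mult mult.assoc)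
next
  case True
  have "occupation u (cball x d) \<le> 0"
  proof (rule ennreal_le_epsilon)
    fix e :: real assume e: "0 < e"
    define \<delta> where "\<delta> = min 1 ((e / C) powr (1 / s))"
    have \<delta>: "0 < \<delta>" "\<delta> \<le> 1" "\<delta> \<le> (e / C) powr (1 / s)" using e C(1) by (simp_all add: \<delta>_def)
    have "\<delta> powr s \<le> ((e / C) powr (1 / s)) powr s" using \<delta> s_pos by (intro powr_mono2) simp_all
    also have "\<dots> = e / C" using s_pos e C(1) by (simp add: powr_powr)
    finally have "C * \<delta> powr s \<le> e" using C(1) by (simp add: le_divide_eq mult.commute)
    have "occupation u (cball x d) \<le> occupation u (ball x \<delta>)"
      using \<delta>(1) True by (intro occupation_mono[OF u]) simp_all
    also have "\<dots> \<le> ennreal (C * \<delta> powr s)" using C(2) \<delta> by simp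
    also have "\<dots> \<le> ennreal e" using \<open>C * \<delta> powr s \<le> e\<close> by (rule ennreal_leI)
    finally show "occupation u (cball x d) \<le> 0 + ennreal e" by simp
  qed
  then show ?thesis by simp
qed

text \<open>
  The mass distribution principle: the times that a curve spends in the sets of a cover of \<open>K\<close> add
  up to at least \<open>1\<close>, and each is at most a constant times the \<open>s\<close>-th power of the diameter. For
  diameters up to \<open>1\<close>, smaller exponents only increase the sum.
\<close>

lemma hausdorff_measure_pos:
  assumes osc: "open_set_condition N S" and V: "V \<noteq> {}" and t: "0 \<le> t" "t \<le> s"
  shows "0 < hausdorff_measure t K"
proof -
  obtain u where u: "u \<in> V" using V by blast
  obtain C where "0 < C \<and> (\<forall>u\<in>V. \<forall>x. \<forall>\<delta>. 0 < \<delta> \<and> \<delta> \<le> 1 \<longrightarrow> occupation u (ball x \<delta>) \<le> ennreal (C * \<delta> powr s))"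
    using occupation_ball_le[OF osc] ..
  then have C: "0 < C" "\<forall>x. \<forall>\<delta>. 0 < \<delta> \<and> \<delta> \<le> 1 \<longrightarrow> occupation u (ball x \<delta>) \<le> ennreal (C * \<delta> powr s)"
    using u by simp_all
  define C' where "C' = C * 2 powr s"
  have C': "0 < C'" using C(1) by (simp add: C'_def)
  have "1 / ennreal C' \<le> hausdorff_premeasure t (1 / 2) K"
    unfolding hausdorff_premeasure_def
  proof (rule INF_greatest)
    fix U :: "nat \<Rightarrow> 'a set"
    assume "U \<in> {U. K \<subseteq> (\<Union>i. U i) \<and> (\<forall>i. bounded (U i) \<and> diameter (U i) \<le> 1 / 2)}"
    then have cover: "K \<subseteq> (\<Union>i. U i)" and U: "\<And>i. bounded (U i)" "\<And>i. diameter (U i) \<le> 1 / 2" by simp_all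
    define x where "x i = (SOME x. x \<in> U i)" for i
    define B where "B i = (if U i = {} then {} else cball (x i) (diameter (U i)))" for i
    have B_borel: "B i \<in> sets borel" for i by (simp add: B_def)
    have U_B: "U i \<subseteq> B i" for i
    proof
      fix y assume y: "y \<in> U i"
      then have "x i \<in> U i" unfolding x_def by (rule someI)
      then have "dist (x i) y \<le> diameter (U i)" using diameter_bounded_bound[OF U(1)] y by blast
      then show "y \<in> B i" using y by (auto simp: B_def)
    qed
    have le: "occupation u (B i) \<le> ennreal C' * diam_pow t (U i)" for i
    proof (cases "U i = {}")
      case True
      then show ?thesis by (simp add: B_def occupation_def)
    next
      case False
      have d: "0 \<le> diameter (U i)" using U(1) by (rule diameter_ge_0)
      have "ennreal (diameter (U i) powr s) \<le> diam_pow t (U i)"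
      proof (cases "t = 0")
        case True
        have "diameter (U i) powr s \<le> 1 powr s" using d U(2)[of i] s_pos by (intro powr_mono2) simp_all
        then show ?thesis using True False by (simp add: diam_pow_def)
      next
        case t0: False
        have "diameter (U i) powr s \<le> diameter (U i) powr t"
          using d U(2)[of i] t by (cases "diameter (U i) = 0") (simp_all add: powr_mono')
        then show ?thesis using t0 False by (simp add: diam_pow_def ennreal_leI)
      qed
      then have "ennreal C' * ennreal (diameter (U i) powr s) \<le> ennreal C' * diam_pow t (U i)"
        by (rule mult_left_mono) simp
      moreover have "occupation u (B i) \<le> ennreal (C' * diameter (U i) powr s)"
        using occupation_cball_le[OF C u d U(2)] False by (simp add: B_def C'_def)
      ultimately show ?thesis using C' by (simp add: ennreal_mult)
    qed
    have "{0..1} \<subseteq> (\<Union>i. {\<tau> \<in> {0..1}. curve u \<tau> \<in> B i})"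
    proof
      fix \<tau> :: real assume \<tau>: "\<tau> \<in> {0..1}"
      then have "curve u \<tau> \<in> (\<Union>i. U i)" using curve_in_K[OF u] cover by blast
      then obtain i where "curve u \<tau> \<in> U i" by blast
      then have "\<tau> \<in> {\<tau> \<in> {0..1}. curve u \<tau> \<in> B i}" using U_B \<tau> by blast
      then show "\<tau> \<in> (\<Union>i. {\<tau> \<in> {0..1}. curve u \<tau> \<in> B i})" by (rule UN_I[OF UNIV_I])
    qed
    then have "emeasure lebesgue {0..1::real} \<le> emeasure lebesgue (\<Union>i. {\<tau> \<in> {0..1}. curve u \<tau> \<in> B i})"
      using occupation_set[OF u B_borel] by (intro emeasure_mono sets.countable_UN) auto
    also have "\<dots> \<le> (\<Sum>i. occupation u (B i))"
      unfolding occupation_def using occupation_set[OF u B_borel]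
      by (intro emeasure_subadditive_countably) auto
    also have "\<dots> \<le> (\<Sum>i. ennreal C' * diam_pow t (U i))" by (intro suminf_le le) simp_all
    finally have "1 \<le> ennreal C' * (\<Sum>i. diam_pow t (U i))" by simp
    then show "1 / ennreal C' \<le> (\<Sum>i. diam_pow t (U i))"
      using C' by (intro divide_le_posI_ennreal) simp_all
  qed
  also have "\<dots> \<le> hausdorff_measure t K"
    unfolding hausdorff_measure_def by (intro SUP_upper) simp
  finally have le: "1 / ennreal C' \<le> hausdorff_measure t K" .
  have "0 < 1 / ennreal C'" by (simp add: ennreal_zero_less_divide)
  then show ?thesis using le by (rule less_le_trans)
qed

lemma curve_holder_at:
  assumes u: "u \<in> V"
  obtains C where "0 < C" "\<forall>x\<in>{0..1}. \<forall>y\<in>{0..1}. dist (curve u x) (curve u y) \<le> C * \<bar>x - y\<bar> powr (1 / s)"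
proof -
  obtain C where C: "0 < C \<and> (\<forall>u\<in>V. \<forall>x\<in>{0..1}. \<forall>y\<in>{0..1}.
      dist (curve u x) (curve u y) \<le> C * \<bar>x - y\<bar> powr (1 / s))"
    using curve_holder ..
  show thesis by (rule that[OF conjunct1[OF C] bspec[OF conjunct2[OF C] u]])
qed

lemma hausdorff_measure_finite:
  assumes V: "V \<noteq> {}" shows "hausdorff_measure s K < \<infinity>"
proof -
  obtain u where u: "u \<in> V" using V by blast
  obtain C where C: "0 < C" "\<forall>x\<in>{0..1}. \<forall>y\<in>{0..1}. dist (curve u x) (curve u y) \<le> C * \<bar>x - y\<bar> powr (1 / s)"
    using u by (rule curve_holder_at)
  have "hausdorff_measure s (curve u ` {0..1}) < \<infinity>"
    using s_pos C(1) bspec[OF bspec[OF C(2)]] by (rule hausdorff_measure_holder_curve_finite)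
  then show ?thesis unfolding curve_onto[OF u] .
qed

lemma hausdorff_dim_eq:
  assumes osc: "open_set_condition N S" and V: "V \<noteq> {}"
  shows "hausdorff_dim K = s"
proof -
  obtain u where u: "u \<in> V" using V by blast
  obtain C where C: "0 < C" "\<forall>x\<in>{0..1}. \<forall>y\<in>{0..1}. dist (curve u x) (curve u y) \<le> C * \<bar>x - y\<bar> powr (1 / s)"
    using u by (rule curve_holder_at)
  have zero: "hausdorff_measure t K = 0" if "s < t" for t
  proof -
    have "hausdorff_measure t (curve u ` {0..1}) = 0"
      using s_pos that C(1) bspec[OF bspec[OF C(2)]] by (rule hausdorff_measure_holder_curve_zero)
    then show ?thesis unfolding curve_onto[OF u] .
  qed
  have "{t. 0 \<le> t \<and> hausdorff_measure t K = 0} = {s<..}"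
  proof (intro equalityI subsetI)
    fix t assume t: "t \<in> {t. 0 \<le> t \<and> hausdorff_measure t K = 0}"
    then show "t \<in> {s<..}" using hausdorff_measure_pos[OF osc V, of t] by force
  next
    fix t assume "t \<in> {s<..}"
    then show "t \<in> {t. 0 \<le> t \<and> hausdorff_measure t K = 0}" using zero s_pos by simp
  qed
  then show ?thesis unfolding hausdorff_dim_def by simp
qed

section \<open>Arcs carry at most their share of the measure\<close>

definition fair_arc :: "'b \<Rightarrow> real \<Rightarrow> real \<Rightarrow> bool" where
  "fair_arc u p q \<longleftrightarrow> 0 \<le> p \<and> p \<le> q \<and> q \<le> 1 \<and>
     hausdorff_measure s (curve u ` {p..q}) \<le> hausdorff_measure s K * ennreal (q - p)"

lemma fair_arc_refl: "0 \<le> p \<Longrightarrow> p \<le> 1 \<Longrightarrow> fair_arc u p p"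
  by (simp add: fair_arc_def hausdorff_measure_singleton[OF s_pos])

lemma fair_arc_whole: "u \<in> V \<Longrightarrow> fair_arc u 0 1"
  by (simp add: fair_arc_def curve_onto)

lemma fair_arc_trans:
  assumes "fair_arc u p q" "fair_arc u q v" shows "fair_arc u p v"
proof -
  have ord: "0 \<le> p" "p \<le> q" "q \<le> v" "v \<le> 1" using assms by (auto simp: fair_arc_def)
  have "{p..v} = {p..q} \<union> {q..v}" using ord by auto
  then have "hausdorff_measure s (curve u ` {p..v})
      \<le> hausdorff_measure s (curve u ` {p..q}) + hausdorff_measure s (curve u ` {q..v})"
    by (simp only: image_Un hausdorff_measure_Un_le)
  also have "\<dots> \<le> hausdorff_measure s K * ennreal (q - p) + hausdorff_measure s K * ennreal (v - q)"
    using assms by (intro add_mono) (simp_all add: fair_arc_def)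
  also have "\<dots> = hausdorff_measure s K * ennreal (v - p)"
    using ord by (simp flip: distrib_left ennreal_plus)
  finally show ?thesis using ord by (simp add: fair_arc_def)
qed

lemma fair_arc_cell:
  assumes u: "u \<in> V" and k: "k < N" and fair: "fair_arc (edge u k) p q"
  shows "fair_arc u (mark u k + weight u k * p) (mark u k + weight u k * q)"
proof -
  note j = idx_range[OF u k]
  have w: "0 < weight u k" by (rule weight_bounds(1)[OF u k])
  have pq: "0 \<le> p" "p \<le> q" "q \<le> 1" using fair by (auto simp: fair_arc_def)
  let ?p = "mark u k + weight u k * p" and ?q = "mark u k + weight u k * q"
  have "curve u ` {?p..?q} \<subseteq> S (idx u k) ` curve (edge u k) ` {p..q}"
  proof (rule image_subsetI)
    fix t assume t: "t \<in> {?p..?q}"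
    define t' where "t' = (t - mark u k) / weight u k"
    have t_eq: "t = mark u k + weight u k * t'" using w by (simp add: t'_def)
    have "t' \<in> {p..q}" using t w by (simp add: t_eq)
    moreover from this have "t' \<in> {0..1}" using pq by simp
    then have "curve u t = S (idx u k) (curve (edge u k) t')"
      unfolding t_eq by (rule curve_cell[OF u k])
    ultimately show "curve u t \<in> S (idx u k) ` curve (edge u k) ` {p..q}" by simp
  qed
  then have "hausdorff_measure s (curve u ` {?p..?q})
      \<le> hausdorff_measure s (S (idx u k) ` curve (edge u k) ` {p..q})"
    by (rule hausdorff_measure_mono)
  also have "\<dots> \<le> ennreal (weight u k) * hausdorff_measure s (curve (edge u k) ` {p..q})"
    unfolding weight_def using similitude[OF j]
    by (intro hausdorff_measure_lipschitz_image_le ratio(1)[OF j] s_pos) simp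
  also have "\<dots> \<le> ennreal (weight u k) * (hausdorff_measure s K * ennreal (q - p))"
    using fair by (intro mult_left_mono) (simp_all add: fair_arc_def)
  also have "\<dots> = hausdorff_measure s K * ennreal (?q - ?p)"
    using w pq by (simp add: mult.left_commute flip: ennreal_mult' right_diff_distrib)
  finally have "hausdorff_measure s (curve u ` {?p..?q}) \<le> hausdorff_measure s K * ennreal (?q - ?p)" .
  moreover have "?p \<le> ?q" using w pq by simp
  ultimately show ?thesis
    using cell_range[OF u k, of p] cell_range[OF u k, of q] pq by (simp add: fair_arc_def)
qed

lemma fair_arc_marks:
  assumes u: "u \<in> V" shows "i \<le> k \<Longrightarrow> k \<le> N \<Longrightarrow> fair_arc u (mark u i) (mark u k)"
proof (induction k)
  case 0
  then show ?case by (simp add: fair_arc_refl)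
next
  case (Suc k)
  show ?case
  proof (cases "i = Suc k")
    case True
    then show ?thesis using mark_range[OF u] Suc.prems by (simp add: fair_arc_refl)
  next
    case False
    have k: "k < N" using Suc.prems by simp
    have "fair_arc u (mark u k) (mark u (Suc k))"
      using fair_arc_cell[OF u k fair_arc_whole[OF edge[OF u k]]] by (simp add: mark_Suc)
    moreover have "fair_arc u (mark u i) (mark u k)" using Suc False by simp
    ultimately show ?thesis by (rule fair_arc_trans[rotated])
  qed
qed

text \<open>
  The points \<open>p\<close> and \<open>q\<close> are ends of cells of level \<open>n\<close> around \<open>a\<close> and \<open>b\<close>. The fair arcs to the ends \<open>0\<close>
  and \<open>1\<close> are carried along in the induction because, when \<open>a\<close> and \<open>b\<close> lie in different cells, the arc
  from \<open>p\<close> to \<open>q\<close> is composed of an arc to the end of the cell of \<open>a\<close>, of full cells, and of an arc from the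
  start of the cell of \<open>b\<close>.
\<close>

lemma fair_arc_near:
  "u \<in> V \<Longrightarrow> 0 \<le> a \<Longrightarrow> a \<le> b \<Longrightarrow> b \<le> 1 \<Longrightarrow>
    \<exists>p q. p \<le> a \<and> b \<le> q \<and> a - p \<le> (rmax powr s) ^ n \<and> q - b \<le> (rmax powr s) ^ n \<and>
      fair_arc u 0 p \<and> fair_arc u p q \<and> fair_arc u q 1"
proof (induction n arbitrary: u a b)
  case 0
  then show ?case
    by (intro exI[of _ 0] exI[of _ 1]) (simp add: fair_arc_refl fair_arc_whole)
next
  case (Suc n)
  note u = Suc.prems(1)
  let ?R = "rmax powr s"
  have shrink: "weight u k * d \<le> ?R ^ Suc n" if "k < N" "d \<le> ?R ^ n" for k d
  proof -
    have "weight u k * d \<le> weight u k * ?R ^ n"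
      using that weight_bounds(1)[OF u that(1)] by (intro mult_left_mono) simp_all
    also have "\<dots> \<le> ?R * ?R ^ n"
      using weight_bounds(4)[OF u that(1)] by (intro mult_right_mono) simp_all
    finally show ?thesis by simp
  qed
  have mark_1: "fair_arc u (mark u i) 1" "fair_arc u 0 (mark u i)" if "i \<le> N" for i
    using fair_arc_marks[OF u that order_refl] fair_arc_marks[OF u le0 that] mark_N[OF u] by simp_all
  have a01: "a \<in> {0..1}" and b01: "b \<in> {0..1}" using Suc.prems by simp_all
  define i where "i = cell u a"
  have i: "i < N" "mark u i \<le> a" "a \<le> mark u (Suc i)" unfolding i_def by (rule cell[OF u a01])+
  define a' where "a' = (a - mark u i) / weight u i"
  have a': "a' \<in> {0..1}" "a = mark u i + weight u i * a'"
    unfolding a'_def by (rule cell_coordinate[OF u i])+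
  have wi: "0 < weight u i" by (rule weight_bounds(1)[OF u i(1)])
  note vi = edge[OF u i(1)]
  have start: "fair_arc u 0 (mark u i + weight u i * p)" if "fair_arc (edge u i) 0 p" for p
  proof (rule fair_arc_trans)
    show "fair_arc u 0 (mark u i)" using mark_1(2)[of i] i(1) by simp
    show "fair_arc u (mark u i) (mark u i + weight u i * p)"
      using fair_arc_cell[OF u i(1) that] by simp
  qed
  have stop: "fair_arc u (mark u k + weight u k * q) 1" if k: "k < N" and "fair_arc (edge u k) q 1" for k q
  proof (rule fair_arc_trans)
    show "fair_arc u (mark u k + weight u k * q) (mark u (Suc k))"
      using fair_arc_cell[OF u k that(2)] by (simp add: mark_Suc)
    show "fair_arc u (mark u (Suc k)) 1" using mark_1(1)[of "Suc k"] k by simp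
  qed
  show ?case
  proof (cases "b \<le> mark u (Suc i)")
    case True
    define b' where "b' = (b - mark u i) / weight u i"
    have "mark u i \<le> b" using i(2) Suc.prems(3) by linarith
    then have b': "b' \<in> {0..1}" "b = mark u i + weight u i * b'"
      unfolding b'_def using True by (intro cell_coordinate[OF u i(1)]; simp)+
    have "a' \<le> b'" unfolding a'_def b'_def using Suc.prems(3) wi by (intro divide_right_mono) simp_all
    then obtain p q where pq: "p \<le> a'" "b' \<le> q" "a' - p \<le> ?R ^ n" "q - b' \<le> ?R ^ n"
      "fair_arc (edge u i) 0 p" "fair_arc (edge u i) p q" "fair_arc (edge u i) q 1"
      using Suc.IH[OF vi, of a' b'] a'(1) b'(1) by auto
    show ?thesis
    proof (intro exI conjI)
      show "mark u i + weight u i * p \<le> a" "b \<le> mark u i + weight u i * q"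
        using pq(1,2) wi unfolding a'(2) b'(2) by simp_all
      show "a - (mark u i + weight u i * p) \<le> ?R ^ Suc n"
        using shrink[OF i(1) pq(3)] unfolding a'(2) by (simp add: right_diff_distrib)
      show "mark u i + weight u i * q - b \<le> ?R ^ Suc n"
        using shrink[OF i(1) pq(4)] unfolding b'(2) by (simp add: right_diff_distrib)
      show "fair_arc u 0 (mark u i + weight u i * p)" by (rule start[OF pq(5)])
      show "fair_arc u (mark u i + weight u i * p) (mark u i + weight u i * q)"
        by (rule fair_arc_cell[OF u i(1) pq(6)])
      show "fair_arc u (mark u i + weight u i * q) 1" by (rule stop[OF i(1) pq(7)])
    qed
  next
    case False
    define k where "k = cell u b"
    have k: "k < N" "mark u k \<le> b" "b \<le> mark u (Suc k)" unfolding k_def by (rule cell[OF u b01])+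
    have "i < k"
    proof (rule ccontr)
      assume "\<not> i < k"
      then have "mark u (Suc k) \<le> mark u (Suc i)" using i(1) by (intro mark_le[OF u]) simp_all
      then show False using False k(3) by linarith
    qed
    define b' where "b' = (b - mark u k) / weight u k"
    have b': "b' \<in> {0..1}" "b = mark u k + weight u k * b'"
      unfolding b'_def by (rule cell_coordinate[OF u k])+
    have wk: "0 < weight u k" by (rule weight_bounds(1)[OF u k(1)])
    obtain p p' where p: "p \<le> a'" "a' - p \<le> ?R ^ n" "fair_arc (edge u i) 0 p"
      "fair_arc (edge u i) p p'" "fair_arc (edge u i) p' 1"
      using Suc.IH[OF vi, of a' a'] a'(1) by auto
    obtain q q' where q: "b' \<le> q" "q - b' \<le> ?R ^ n" "fair_arc (edge u k) 0 q'"
      "fair_arc (edge u k) q' q" "fair_arc (edge u k) q 1"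
      using Suc.IH[OF edge[OF u k(1)], of b' b'] b'(1) by auto
    show ?thesis
    proof (intro exI conjI)
      show "mark u i + weight u i * p \<le> a" using p(1) wi unfolding a'(2) by simp
      show "b \<le> mark u k + weight u k * q" using q(1) wk unfolding b'(2) by simp
      show "a - (mark u i + weight u i * p) \<le> ?R ^ Suc n"
        using shrink[OF i(1) p(2)] unfolding a'(2) by (simp add: right_diff_distrib)
      show "mark u k + weight u k * q - b \<le> ?R ^ Suc n"
        using shrink[OF k(1) q(2)] unfolding b'(2) by (simp add: right_diff_distrib)
      show "fair_arc u 0 (mark u i + weight u i * p)" by (rule start[OF p(3)])
      have "fair_arc u (mark u i + weight u i * p) (mark u (Suc i))"
        using fair_arc_cell[OF u i(1) fair_arc_trans[OF p(4,5)]] by (simp add: mark_Suc)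
      moreover have "fair_arc u (mark u (Suc i)) (mark u k)"
        using \<open>i < k\<close> k(1) by (intro fair_arc_marks[OF u]) simp_all
      moreover have "fair_arc u (mark u k) (mark u k + weight u k * q)"
        using fair_arc_cell[OF u k(1) fair_arc_trans[OF q(3,4)]] by simp
      ultimately show "fair_arc u (mark u i + weight u i * p) (mark u k + weight u k * q)"
        by (rule fair_arc_trans[OF fair_arc_trans])
      show "fair_arc u (mark u k + weight u k * q) 1" by (rule stop[OF k(1) q(5)])
    qed
  qed
qed

lemma hausdorff_measure_arc_le:
  assumes u: "u \<in> V" and ab: "0 \<le> a" "a \<le> b" "b \<le> 1"
  shows "hausdorff_measure s (curve u ` {a..b}) \<le> hausdorff_measure s K * ennreal (b - a)"
proof -
  have "hausdorff_measure s K < \<infinity>" using u by (intro hausdorff_measure_finite) blast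
  then obtain c where c: "hausdorff_measure s K = ennreal c" "0 \<le> c"
    by (cases "hausdorff_measure s K") auto
  let ?R = "rmax powr s"
  have le: "hausdorff_measure s (curve u ` {a..b}) \<le> ennreal (c * (b - a + 2 * ?R ^ n))" for n
  proof -
    obtain p q where pq: "p \<le> a" "b \<le> q" "a - p \<le> ?R ^ n" "q - b \<le> ?R ^ n" "fair_arc u p q"
      using fair_arc_near[OF u ab, of n] by blast
    have "hausdorff_measure s (curve u ` {a..b}) \<le> hausdorff_measure s (curve u ` {p..q})"
      using pq by (intro hausdorff_measure_mono image_mono) simp
    also have "\<dots> \<le> ennreal c * ennreal (q - p)" using pq(5) c(1) by (simp add: fair_arc_def)
    also have "\<dots> = ennreal (c * (q - p))" using c(2) by (simp add: ennreal_mult')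
    also have "\<dots> \<le> ennreal (c * (b - a + 2 * ?R ^ n))"
      using pq c(2) by (intro ennreal_leI mult_left_mono) simp_all
    finally show ?thesis .
  qed
  have "?R < 1" using powr_less_mono2[of s rmax 1] rmax s_pos by simp
  then have "(\<lambda>n. ?R ^ n) \<longlonglongrightarrow> 0" by (intro LIMSEQ_power_zero) simp
  then have "(\<lambda>n. c * (b - a + 2 * ?R ^ n)) \<longlonglongrightarrow> c * (b - a + 2 * 0)"
    by (intro tendsto_mult_left tendsto_add tendsto_const)
  then have "(\<lambda>n. ennreal (c * (b - a + 2 * ?R ^ n))) \<longlonglongrightarrow> ennreal (c * (b - a + 2 * 0))"
    by (rule tendsto_ennrealI)
  then have "hausdorff_measure s (curve u ` {a..b}) \<le> ennreal (c * (b - a + 2 * 0))"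
    by (rule tendsto_lowerbound) (simp_all add: le)
  then show ?thesis using c ab by (simp add: ennreal_mult')
qed

text \<open>
  The curve is allowed to be changed outside \<open>[0, 1]\<close>, so that the lemma also covers the concatenation
  of a single curve.
\<close>

lemma curve_optimal:
  assumes osc: "open_set_condition N S" and u: "u \<in> V"
    and \<psi>: "\<And>t. t \<in> {0..1} \<Longrightarrow> \<psi> t = curve u t"
  shows "optimal_parametrization s K \<psi>"
proof (rule optimal_parametrizationI)
  have V: "V \<noteq> {}" using u by blast
  have image: "\<psi> ` X = curve u ` X" if "X \<subseteq> {0..1}" for X
    using \<psi> that by (intro image_cong) auto
  show "0 < s" by (rule s_pos)
  show "\<psi> ` {0..1} = K" using image[of "{0..1}"] curve_onto[OF u] by simp
  show "0 < hausdorff_measure s K" using s_pos by (intro hausdorff_measure_pos[OF osc V]) simp_all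
  show "hausdorff_measure s K < \<infinity>" by (rule hausdorff_measure_finite[OF V])
  show "hausdorff_measure s (\<psi> ` {a..b}) \<le> hausdorff_measure s K * ennreal (b - a)"
    if "0 \<le> a" "a \<le> b" "b \<le> 1" for a b
    using hausdorff_measure_arc_le[OF u that] image[of "{a..b}"] that by simp
  obtain C where "0 < C" "\<forall>x\<in>{0..1}. \<forall>y\<in>{0..1}. dist (curve u x) (curve u y) \<le> C * \<bar>x - y\<bar> powr (1 / s)"
    using u by (rule curve_holder_at)
  then show "\<exists>c'>0. \<forall>x\<in>{0..1}. \<forall>y\<in>{0..1}. dist (\<psi> x) (\<psi> y) \<le> c' * \<bar>x - y\<bar> powr (1 / s)"
    using \<psi> by (intro exI[of _ C]) simp
qed

end

section \<open>Traveling trails and space-filling curves\<close>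

text \<open>
  The sum is \<open>N \<ge> 2\<close> at exponent \<open>0\<close> and falls below \<open>1\<close> for large exponents, so it
  equals \<open>1\<close> in between.
\<close>

lemma moran_exponent_exists:
  fixes r :: "nat \<Rightarrow> real"
  assumes N: "2 \<le> N" and r: "\<And>j. j \<in> {1..N} \<Longrightarrow> 0 < r j \<and> r j < 1"
  shows "\<exists>s>0. (\<Sum>j=1..N. r j powr s) = 1"
proof -
  define R where "R = Max (r ` {1..N})"
  have fin: "finite (r ` {1..N})" "r ` {1..N} \<noteq> {}" using N by auto
  have R_ge: "r j \<le> R" if "j \<in> {1..N}" for j unfolding R_def using fin(1) that by (intro Max_ge) simp_all
  have R1: "R < 1" unfolding R_def using fin r by (subst Max_less_iff) auto
  have R0: "0 < R" using R_ge[of 1] r[of 1] N by simp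
  obtain n where n: "R ^ n < 1 / real N" using real_arch_pow_inv[of "1 / real N" R] N R1 by auto
  have f0: "(\<Sum>j=1..N. r j powr 0) = real N"
  proof -
    have "(\<Sum>j=1..N. r j powr 0) = (\<Sum>j=1..N. 1)" using r by (intro sum.cong) force+
    then show ?thesis by simp
  qed
  have "(\<Sum>j=1..N. r j powr real n) \<le> (\<Sum>j=1..N. R ^ n)"
  proof (rule sum_mono)
    fix j assume j: "j \<in> {1..N}"
    have "r j powr real n = r j ^ n" using r[OF j] by (intro powr_realpow) simp
    also have "\<dots> \<le> R ^ n" using r[OF j] R_ge[OF j] by (intro power_mono) simp_all
    finally show "r j powr real n \<le> R ^ n" .
  qed
  also have "\<dots> = real N * R ^ n" by simp
  also have "\<dots> < 1" using n N by (simp add: less_divide_eq mult.commute)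
  finally have fn: "(\<Sum>j=1..N. r j powr real n) \<le> 1" by simp
  have "continuous_on {0..real n} (\<lambda>s. \<Sum>j=1..N. r j powr s)"
    using r by (intro continuous_on_sum continuous_on_powr continuous_on_const continuous_on_id) force
  then obtain s where s: "0 \<le> s" "(\<Sum>j=1..N. r j powr s) = 1"
    using IVT2'[of "\<lambda>s. \<Sum>j=1..N. r j powr s" "real n" 1 0] fn f0 N by auto
  then have "s \<noteq> 0" using f0 N by auto
  then show ?thesis using s by (intro exI[of _ s]) simp
qed

lemma cas_nth:
  "pre_digraph.cas G x p y \<Longrightarrow> p \<noteq> [] \<Longrightarrow>
    tail G (p ! 0) = x \<and> head G (p ! (length p - 1)) = y \<and>
    (\<forall>k. Suc k < length p \<longrightarrow> head G (p ! k) = tail G (p ! Suc k))"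
proof (induction p arbitrary: x)
  case (Cons e es)
  have e: "tail G e = x" and es: "pre_digraph.cas G (head G e) es y"
    using Cons.prems(1) by (simp_all add: pre_digraph.cas.simps)
  show ?case
  proof (cases es)
    case Nil
    then show ?thesis using e es by (simp add: pre_digraph.cas.simps)
  next
    case (Cons e' es')
    then have IH: "tail G (es ! 0) = head G e" "head G (es ! (length es - 1)) = y"
      "\<forall>k. Suc k < length es \<longrightarrow> head G (es ! k) = tail G (es ! Suc k)"
      using Cons.IH[OF es] by simp_all
    have "head G ((e # es) ! k) = tail G ((e # es) ! Suc k)" if "Suc k < length (e # es)" for k
      using that IH by (cases k) simp_all
    then show ?thesis using e IH(2) Cons by simp
  qed
qed simp

lemma traveling_trail_indices:
  assumes p: "traveling_trail N S \<Lambda> p"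
  shows "snd ` set p = {1..N}"
proof
  have "set p \<subseteq> arcs (refined_graph N S \<Lambda>)"
    using p unfolding traveling_trail_def is_trail_def pre_digraph.trail_def pre_digraph.awalk_def by blast
  then show "snd ` set p \<subseteq> {1..N}" by (auto simp: refined_graph_def image_graph_def)
  show "{1..N} \<subseteq> snd ` set p"
  proof
    fix j assume "j \<in> {1..N}"
    then obtain e where "e \<in> set p" "e \<in> arcs (image_graph S \<Lambda> j)"
      using p unfolding traveling_trail_def by blast
    then show "j \<in> snd ` set p" by (force simp: image_graph_def)
  qed
qed

text \<open>
  A list of length \<open>N\<close> in which \<open>N\<close> different indices occur cannot repeat an index.
\<close>

lemma traveling_trail_bij:
  assumes p: "traveling_trail N S \<Lambda> p"
  shows "bij_betw (\<lambda>k. snd (p ! k)) {..<N} {1..N}"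
proof -
  have len: "length p = N" using p by (simp add: traveling_trail_def)
  have set: "set (map snd p) = {1..N}" using traveling_trail_indices[OF p] by simp
  then have "distinct (map snd p)" using len by (intro card_distinct) simp
  then have "bij_betw ((!) (map snd p)) {..<N} {1..N}" using len set by (intro bij_betw_nth) simp_all
  then show ?thesis using len by (subst bij_betw_cong[of _ _ "(!) (map snd p)"]) simp_all
qed

lemma traveling_substitutionI:
  assumes N: "2 \<le> N" and r: "\<And>j. j \<in> {1..N} \<Longrightarrow> 0 < r j \<and> r j < 1"
    and sim: "\<And>j x y. j \<in> {1..N} \<Longrightarrow> dist (S j x) (S j y) = r j * dist x y"
    and s: "0 < s" "(\<Sum>j=1..N. r j powr s) = 1"
    and K: "invariant_set N S K" and A: "A \<subseteq> K" and \<Lambda>: "initial_graph A \<Lambda>"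
    and sub: "edge_to_trail_substitution N S \<Lambda> \<tau>"
    and trav: "\<forall>u\<in>arcs \<Lambda>. traveling_trail N S \<Lambda> (\<tau> u)"
  shows "traveling_substitution S N r s K (arcs \<Lambda>) (tail \<Lambda>) (head \<Lambda>)
    (\<lambda>u k. fst (\<tau> u ! k)) (\<lambda>u k. snd (\<tau> u ! k))"
proof
  have wf: "wf_digraph \<Lambda>" and verts: "verts \<Lambda> = A"
    using \<Lambda> by (auto simp: initial_graph_def spanning_def subgraph_def complete_digraph_def)
  have len: "length (\<tau> u) = N" if "u \<in> arcs \<Lambda>" for u
    using trav that unfolding traveling_trail_def by blast
  have trail: "\<tau> u \<noteq> []" "set (\<tau> u) \<subseteq> arcs (refined_graph N S \<Lambda>)"
    "pre_digraph.cas (refined_graph N S \<Lambda>) (tail \<Lambda> u) (\<tau> u) (head \<Lambda> u)" if "u \<in> arcs \<Lambda>" for u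
    using sub that unfolding edge_to_trail_substitution_def is_trail_def pre_digraph.trail_def
      pre_digraph.awalk_def by blast+
  note walk = cas_nth[OF trail(3) trail(1)]
  have ends: "tail (refined_graph N S \<Lambda>) e = S (snd e) (tail \<Lambda> (fst e))"
    "head (refined_graph N S \<Lambda>) e = S (snd e) (head \<Lambda> (fst e))" for e
    by (simp_all add: refined_graph_def split_beta)
  show "0 < N" using N by simp
  show "0 < r j" "r j < 1" if "j \<in> {1..N}" for j using r[OF that] by simp_all
  show "dist (S j x) (S j y) = r j * dist x y" if "j \<in> {1..N}" for j x y by (rule sim[OF that])
  show "0 < s" "(\<Sum>j=1..N. r j powr s) = 1" "invariant_set N S K" by (fact s K)+
  fix u assume u: "u \<in> arcs \<Lambda>"
  show "tail \<Lambda> u \<in> K" "head \<Lambda> u \<in> K"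
    using wf_digraph.wellformed[OF wf u] verts A by auto
  show "fst (\<tau> u ! k) \<in> arcs \<Lambda>" if "k < N" for k
  proof -
    have "\<tau> u ! k \<in> arcs (refined_graph N S \<Lambda>)" using trail(2)[OF u] len[OF u] that by (auto dest: nth_mem)
    then show ?thesis by (auto simp: refined_graph_def image_graph_def)
  qed
  show "bij_betw (\<lambda>k. snd (\<tau> u ! k)) {..<N} {1..N}" by (rule traveling_trail_bij[OF bspec[OF trav u]])
  show "S (snd (\<tau> u ! 0)) (tail \<Lambda> (fst (\<tau> u ! 0))) = tail \<Lambda> u"
    using walk[OF u u] by (simp add: ends)
  show "S (snd (\<tau> u ! (N - 1))) (head \<Lambda> (fst (\<tau> u ! (N - 1)))) = head \<Lambda> u"
    using walk[OF u u] len[OF u] by (simp add: ends)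
  show "S (snd (\<tau> u ! k)) (head \<Lambda> (fst (\<tau> u ! k))) = S (snd (\<tau> u ! Suc k)) (tail \<Lambda> (fst (\<tau> u ! Suc k)))"
    if "Suc k < N" for k
    using walk[OF u u] len[OF u] that by (simp add: ends)
qed

lemma concatenation_single:
  assumes "len 0 = 1" and "t \<in> {0..1}" shows "concatenation len \<phi> t = \<phi> 0 t"
proof -
  have "(LEAST i. t \<le> (\<Sum>j\<le>i. len j)) = 0"
    using assms by (intro Least_equality) simp_all
  then show ?thesis using assms(1) by (simp add: concatenation_def)
qed

theorem theorem1p2:
  fixes S :: "nat \<Rightarrow> 'a::euclidean_space \<Rightarrow> 'a"
    and N :: nat
    and K A :: "'a set"
    and \<Lambda> :: "('a, 'a \<times> 'a) pre_digraph"
    and \<tau> :: "'a \<times> 'a \<Rightarrow> (('a \<times> 'a) \<times> nat) list"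
  assumes "is_ifs N S"
    and "open_set_condition N S"
    and "invariant_set N S K"
    and "is_skeleton N S K A"
    and "initial_graph A \<Lambda>"
    and "edge_to_trail_substitution N S \<Lambda> \<tau>"
    and "\<forall>u\<in>arcs \<Lambda>. traveling_trail N S \<Lambda> (\<tau> u)"
  shows "leads_to_space_filling_curve S K \<Lambda> \<tau>"
proof -
  have N: "2 \<le> N" and "\<forall>j\<in>{1..N}. \<exists>r. 0 < r \<and> r < 1 \<and> (\<forall>x y. dist (S j x) (S j y) = r * dist x y)"
    using assms(1) unfolding is_ifs_def contractive_similitude_def by auto
  then obtain r where r: "\<forall>j\<in>{1..N}. 0 < r j \<and> r j < 1 \<and> (\<forall>x y. dist (S j x) (S j y) = r j * dist x y)"
    using bchoice[of "{1..N}" "\<lambda>j r. 0 < r \<and> r < 1 \<and> (\<forall>x y. dist (S j x) (S j y) = r * dist x y)"] by blast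
  obtain s where s: "0 < s" "(\<Sum>j=1..N. r j powr s) = 1"
    using moran_exponent_exists[OF N, of r] r by blast
  have A: "A \<subseteq> K" using assms(4) by (simp add: is_skeleton_def)
  interpret traveling_substitution S N r s K "arcs \<Lambda>" "tail \<Lambda>" "head \<Lambda>"
    "\<lambda>u k. fst (\<tau> u ! k)" "\<lambda>u k. snd (\<tau> u ! k)"
    using r by (intro traveling_substitutionI[OF N _ _ s assms(3) A assms(5-7)]) simp_all
  have ne: "arcs \<Lambda> \<noteq> {}" using assms(5) by (simp add: initial_graph_def)
  then obtain u where u: "u \<in> arcs \<Lambda>" by blast
  have dim: "hausdorff_dim K = s" by (rule hausdorff_dim_eq[OF assms(2) ne])
  have H: "0 < hausdorff_measure s K" "hausdorff_measure s K < \<infinity>"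
    using hausdorff_measure_pos[OF assms(2) ne, of s] hausdorff_measure_finite[OF ne] s(1) by simp_all
  have "hausdorff_measure s K / hausdorff_measure s K = 1" using H by (intro ennreal_divide_self) simp_all
  then have len: "enn2real (hausdorff_measure s K / hausdorff_measure s K) = 1" by simp
  have invariant: "graph_directed_invariant_sets S \<Lambda> \<tau> (\<lambda>_. K)"
    unfolding graph_directed_invariant_sets_def
  proof (intro ballI conjI K_nonempty compact_K)
    fix v assume v: "v \<in> arcs \<Lambda>"
    have "K = (\<Union>j\<in>snd ` set (\<tau> v). S j ` K)"
      unfolding traveling_trail_indices[OF bspec[OF assms(7) v]] by (rule K_eq)
    also have "\<dots> = (\<Union>(w, j)\<in>set (\<tau> v). S j ` K)" by (simp add: split_beta)
    finally show "K = (\<Union>(w, j)\<in>set (\<tau> v). S j ` K)" .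
  qed
  have trail: "is_trail \<Lambda> (tail \<Lambda> u) [u] (head \<Lambda> u)"
  proof -
    have "wf_digraph \<Lambda>" using assms(5) by (simp add: initial_graph_def spanning_def subgraph_def)
    then have "tail \<Lambda> u \<in> verts \<Lambda>" using u by (rule wf_digraph.wellformed)
    then show ?thesis
      using u by (simp add: is_trail_def pre_digraph.trail_def pre_digraph.awalk_def pre_digraph.cas.simps)
  qed
  have curve: "optimal_parametrization s K (curve u)" by (rule curve_optimal[OF assms(2) u refl])
  have concat: "optimal_parametrization s K
      (concatenation (\<lambda>i. enn2real (hausdorff_measure s K / hausdorff_measure s K)) (\<lambda>_. curve u))"
    by (rule curve_optimal[OF assms(2) u]) (rule concatenation_single[OF len])
  show ?thesis
    unfolding leads_to_space_filling_curve_def Let_def dim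
  proof (intro exI conjI)
    show "graph_directed_invariant_sets S \<Lambda> \<tau> (\<lambda>_. K)" by (rule invariant)
    show "is_trail \<Lambda> (tail \<Lambda> u) [u] (head \<Lambda> u)" by (rule trail)
    show "K = (\<Union>i<length [u]. K)" by (simp add: lessThan_Suc)
    show "\<forall>i<length [u]. optimal_parametrization s K (curve u) \<and>
        curve u 0 = tail \<Lambda> ([u] ! i) \<and> curve u 1 = head \<Lambda> ([u] ! i)"
      using curve curve_ends[OF u] by simp
    show "optimal_parametrization s K
      (concatenation (\<lambda>i. enn2real (hausdorff_measure s K / hausdorff_measure s K)) (\<lambda>_. curve u))"
      by (rule concat)
  qed simp_all
qed

end
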